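(* Let $(A,R)$ be a Rota-Baxter 3-Lie algebra of weight $\lambda$ and let $(V,R_V,\rho)$ be a representation of it. Set $C_{\rm RB}^{1}(A,V)=C_{\rm 3\text{-}Lie}^{1}(A,V)$ and $C_{\rm RB}^{n+1}(A,V)=C_{\rm 3\text{-}Lie}^{n+1}(A,V)\times C_{\rm 3\text{-}Lie}^{n}(A_R,\tilde V)$ for $n\ge1$, and define $\partial_{RB}:C_{\rm RB}^{n}(A,V)\to C_{\rm RB}^{n+1}(A,V)$ by $$\partial_{RB}(f,g)=(\partial f,\ \partial_R g+(-1)^n\delta f),\qquad (f,g)\in C_{\rm RB}^{n}(A,V)$$ (for $n=1$ there is no component $g$, and $\partial_{RB}f=(\partial f,-\delta f)$). Then $\partial_{RB}$ is a coboundary operator, that is, $\partial_{RB}\partial_{RB}=0$.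
   Context: Fix a field $k$ and $\lambda\in k$. A 3-Lie algebra is a vector space $A$ with a linear map $[\cdot,\cdot,\cdot]:\wedge^3A\to A$ satisfying $[x_1,x_2,[y_1,y_2,y_3]]=[[x_1,x_2,y_1],y_2,y_3]+[y_1,[x_1,x_2,y_2],y_3]+[y_1,y_2,[x_1,x_2,y_3]]$. A Rota-Baxter operator of weight $\lambda$ on $A$ is a linear map $R:A\to A$ with $[Rx,Ry,Rz]=R([x,y,z]_R)$, where $$[x,y,z]_R=[Rx,Ry,z]+[Rx,y,Rz]+[x,Ry,Rz]+\lambda([Rx,y,z]+[x,Ry,z]+[x,y,Rz])+\lambda^2[x,y,z];$$ then $(A,R)$ is a Rota-Baxter 3-Lie algebra of weight $\lambda$. The space $A$ with the bracket $[\cdot,\cdot,\cdot]_R$ is again a 3-Lie algebra, denoted $A_R$ (and $R$ is a Rota-Baxter operator of weight $\lambda$ on it). A representation of a 3-Lie algebra $A$ is a vector space $V$ with a skew-symmetric bilinear map $\rho:A\wedge A\to\mathfrak{gl}(V)$ such that $\rho(x_1,x_2)\rho(x_3,x_4)-\rho(x_3,x_4)\rho(x_1,x_2)=\rho([x_1,x_2,x_3],x_4)-\rho([x_1,x_2,x_4],x_3)$ and $\rho([x_1,x_2,x_3],x_4)=\rho(x_1,x_2)\rho(x_3,x_4)+\rho(x_2,x_3)\rho(x_1,x_4)+\rho(x_3,x_1)\rho(x_2,x_4)$. A representation of $(A,R)$ is a triple $(V,R_V,\rho)$, with $(V,\rho)$ a representation of $A$ and $R_V:V\to V$ linear such that $$\rho(Rx_1,Rx_2)R_V=R_V\rho(Rx_1,Rx_2)+R_V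 S(x_1,x_2)R_V+\lambda R_V S(x_1,x_2),\quad S(x_1,x_2)=\rho(Rx_1,x_2)+\rho(x_1,Rx_2)+\lambda\rho(x_1,x_2).$$ $\tilde V$ denotes the space $V$ with $\tilde\rho(x_1,x_2)=\rho(Rx_1,Rx_2)-R_VS(x_1,x_2)$, which is a representation of $A_R$. Cochains: for a 3-Lie algebra $A$, a representation $(V,\rho)$ and $p\ge1$, with $L=\wedge^2A$, $C_{\rm 3\text{-}Lie}^{p}(A,V)$ is the space of linear maps $f:L^{\otimes(p-1)}\wedge A\to V$, i.e. multilinear maps $f(X_1,\dots,X_{p-1},z)$ with $X_i=x_i\wedge y_i\in L$, $z\in A$, alternating in the last three entries $x_{p-1},y_{p-1},z$ when $p\ge2$. Write $[X,z]=[x,y,z]$ and $\rho(X)=\rho(x,y)$ for $X=x\wedge y$, and $[X,Y]_F=[x_1,x_2,y_1]\wedge y_2+y_1\wedge[x_1,x_2,y_2]$ for $X=x_1\wedge x_2$, $Y=y_1\wedge y_2$. The coboundary $\partial:C_{\rm 3\text{-}Lie}^{p}(A,V)\to C_{\rm 3\text{-}Lie}^{p+1}(A,V)$ is $$\begin{aligned}(\partial f)(X_1,\dots,X_p,z)=&\sum_{1\le i<k\le p}(-1)^i f(X_1,\dots,\hat X_i,\dots,X_{k-1},[X_i,X_k]_F,X_{k+1},\dots,X_p,z)\\&+\sum_{i=1}^p(-1)^i f(X_1,\dots,\hat X_i,\dots,X_p,[X_i,z])+\sum_{i=1}^p(-1)^{i+1}\rho(X_i)f(X_1,\dots,\hat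 X_i,\dots,X_p,z)\\&+(-1)^{p+1}\big(\rho(y_p,z)f(X_1,\dots,X_{p-1},x_p)+\rho(z,x_p)f(X_1,\dots,X_{p-1},y_p)\big).\end{aligned}$$ $\partial_R$ is this same coboundary for the 3-Lie algebra $A_R$ (all brackets, including those in $[\cdot,\cdot]_F$, replaced by $[\cdot,\cdot,\cdot]_R$) with coefficients in $\tilde V$ ($\rho$ replaced by $\tilde\rho$); it acts on $C_{\rm 3\text{-}Lie}^{*}(A_R,\tilde V)$. The map $\delta:C_{\rm 3\text{-}Lie}^{n+1}(A,V)\to C_{\rm 3\text{-}Lie}^{n+1}(A_R,\tilde V)$ ($n\ge0$) is, writing the arguments as $x_1,\dots,x_{2n+1}\in A$, $$\delta f(x_1,\dots,x_{2n+1})=f(Rx_1,\dots,Rx_{2n+1})-R_V\sum_{k=0}^{2n}\lambda^{2n-k}f^{k}(x_1,\dots,x_{2n+1}),$$ where $f^k(x_1,\dots,x_{2n+1})$ is the sum, over all choices of $k$ of the $2n+1$ positions, of $f$ evaluated with $R$ applied to the arguments in the chosen positions and the identity elsewhere; $\lambda^0=1$. *)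

theory Defs
  imports Complex_Main
begin

text \<open>
  Vector spaces are types equipped with a scalar multiplication over an arbitrary field.
  A linear map out of an exterior power is given as an alternating multilinear map; alternating means
  vanishing on repeated arguments, so that characteristic 2 is treated correctly.
\<close>

locale three_lie_algebra = vector_space scale
  for scale :: "'k::field \<Rightarrow> 'a::ab_group_add \<Rightarrow> 'a" +
  fixes br :: "'a \<Rightarrow> 'a \<Rightarrow> 'a \<Rightarrow> 'a"
  assumes br_linear1: "Vector_Spaces.linear scale scale (\<lambda>x. br x y z)"
    and br_linear2: "Vector_Spaces.linear scale scale (\<lambda>y. br x y z)"
    and br_linear3: "Vector_Spaces.linear scale scale (\<lambda>z. br x y z)"
    and br_alt12: "br x x z = 0"
    and br_alt13: "br x y x = 0"
    and br_alt23: "br x y y = 0"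
    and fundamental_identity:
      "br x\<^sub>1 x\<^sub>2 (br y\<^sub>1 y\<^sub>2 y\<^sub>3) =
         br (br x\<^sub>1 x\<^sub>2 y\<^sub>1) y\<^sub>2 y\<^sub>3 + br y\<^sub>1 (br x\<^sub>1 x\<^sub>2 y\<^sub>2) y\<^sub>3 + br y\<^sub>1 y\<^sub>2 (br x\<^sub>1 x\<^sub>2 y\<^sub>3)"

definition br_RB ::
  "('k::field \<Rightarrow> 'a \<Rightarrow> 'a) \<Rightarrow> ('a \<Rightarrow> 'a \<Rightarrow> 'a \<Rightarrow> 'a) \<Rightarrow> 'k \<Rightarrow> ('a \<Rightarrow> 'a)
     \<Rightarrow> 'a \<Rightarrow> 'a \<Rightarrow> 'a \<Rightarrow> 'a::ab_group_add" where
  "br_RB scale br lam R x y z =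
     br (R x) (R y) z + br (R x) y (R z) + br x (R y) (R z)
     + scale lam (br (R x) y z + br x (R y) z + br x y (R z))
     + scale (lam\<^sup>2) (br x y z)"

locale rota_baxter_three_lie_algebra = three_lie_algebra scale br
  for scale :: "'k::field \<Rightarrow> 'a::ab_group_add \<Rightarrow> 'a" and br +
  fixes lam :: 'k and R :: "'a \<Rightarrow> 'a"
  assumes R_linear: "Vector_Spaces.linear scale scale R"
    and rota_baxter: "br (R x) (R y) (R z) = R (br_RB scale br lam R x y z)"

locale three_lie_representation =
  three_lie_algebra scaleA br + V: vector_space scaleV
  for scaleA :: "'k::field \<Rightarrow> 'a::ab_group_add \<Rightarrow> 'a" and br
    and scaleV :: "'k \<Rightarrow> 'v::ab_group_add \<Rightarrow> 'v" +
  fixes rho :: "'a \<Rightarrow> 'a \<Rightarrow> 'v \<Rightarrow> 'v"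
  assumes rho_endo: "Vector_Spaces.linear scaleV scaleV (rho x y)"
    and rho_linear1: "Vector_Spaces.linear scaleA scaleV (\<lambda>x. rho x y v)"
    and rho_linear2: "Vector_Spaces.linear scaleA scaleV (\<lambda>y. rho x y v)"
    and rho_alt: "rho x x v = 0"
    and rho_commutator:
      "rho x\<^sub>1 x\<^sub>2 (rho x\<^sub>3 x\<^sub>4 v) - rho x\<^sub>3 x\<^sub>4 (rho x\<^sub>1 x\<^sub>2 v) =
         rho (br x\<^sub>1 x\<^sub>2 x\<^sub>3) x\<^sub>4 v - rho (br x\<^sub>1 x\<^sub>2 x\<^sub>4) x\<^sub>3 v"
    and rho_bracket:
      "rho (br x\<^sub>1 x\<^sub>2 x\<^sub>3) x\<^sub>4 v =
         rho x\<^sub>1 x\<^sub>2 (rho x\<^sub>3 x\<^sub>4 v) + rho x\<^sub>2 x\<^sub>3 (rho x\<^sub>1 x\<^sub>4 v) + rho x\<^sub>3 x\<^sub>1 (rho x\<^sub>2 x\<^sub>4 v)"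

definition rho_S ::
  "('k::field \<Rightarrow> 'v \<Rightarrow> 'v) \<Rightarrow> ('a \<Rightarrow> 'a \<Rightarrow> 'v \<Rightarrow> 'v) \<Rightarrow> 'k \<Rightarrow> ('a \<Rightarrow> 'a)
     \<Rightarrow> 'a \<Rightarrow> 'a \<Rightarrow> 'v \<Rightarrow> 'v::ab_group_add" where
  "rho_S scaleV rho lam R x y v = rho (R x) y v + rho x (R y) v + scaleV lam (rho x y v)"

definition rho_RB ::
  "('k::field \<Rightarrow> 'v \<Rightarrow> 'v) \<Rightarrow> ('a \<Rightarrow> 'a \<Rightarrow> 'v \<Rightarrow> 'v) \<Rightarrow> 'k \<Rightarrow> ('a \<Rightarrow> 'a) \<Rightarrow> ('v \<Rightarrow> 'v)
     \<Rightarrow> 'a \<Rightarrow> 'a \<Rightarrow> 'v \<Rightarrow> 'v::ab_group_add" where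
  "rho_RB scaleV rho lam R RV x y v = rho (R x) (R y) v - RV (rho_S scaleV rho lam R x y v)"

locale rota_baxter_representation =
  rota_baxter_three_lie_algebra scaleA br lam R + three_lie_representation scaleA br scaleV rho
  for scaleA :: "'k::field \<Rightarrow> 'a::ab_group_add \<Rightarrow> 'a" and br and lam and R
    and scaleV :: "'k \<Rightarrow> 'v::ab_group_add \<Rightarrow> 'v" and rho +
  fixes RV :: "'v \<Rightarrow> 'v"
  assumes RV_linear: "Vector_Spaces.linear scaleV scaleV RV"
    and RV_compat:
      "rho (R x\<^sub>1) (R x\<^sub>2) (RV v) =
         RV (rho (R x\<^sub>1) (R x\<^sub>2) v) + RV (rho_S scaleV rho lam R x\<^sub>1 x\<^sub>2 (RV v))
         + scaleV lam (RV (rho_S scaleV rho lam R x\<^sub>1 x\<^sub>2 v))"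

text \<open>
  A \<open>p\<close>-cochain is a function \<open>f [(x\<^sub>1, y\<^sub>1), \<dots>, (x\<^sub>p\<^sub>-\<^sub>1, y\<^sub>p\<^sub>-\<^sub>1)] z\<close>, where the pair \<open>(x, y)\<close> stands for
  the decomposable element \<open>x \<and> y\<close> of the exterior square. A cochain is set to 0 on lists of the wrong
  length, so that equality of cochains is equality of functions.
\<close>

type_synonym ('a, 'v) cochain = "('a \<times> 'a) list \<Rightarrow> 'a \<Rightarrow> 'v"

definition cochains ::
  "('k::field \<Rightarrow> 'a \<Rightarrow> 'a) \<Rightarrow> ('k \<Rightarrow> 'v \<Rightarrow> 'v) \<Rightarrow> nat
     \<Rightarrow> ('a::ab_group_add, 'v::ab_group_add) cochain set" where
  "cochains scaleA scaleV p = {f.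
     1 \<le> p \<and>
     (\<forall>Xs z. length Xs \<noteq> p - 1 \<longrightarrow> f Xs z = 0) \<and>
     (\<forall>Xs z. length Xs = p - 1 \<longrightarrow>
        Vector_Spaces.linear scaleA scaleV (\<lambda>t. f Xs t) \<and>
        (\<forall>i < p - 1.
           Vector_Spaces.linear scaleA scaleV (\<lambda>t. f (Xs[i := (t, snd (Xs ! i))]) z) \<and>
           Vector_Spaces.linear scaleA scaleV (\<lambda>t. f (Xs[i := (fst (Xs ! i), t)]) z) \<and>
           (fst (Xs ! i) = snd (Xs ! i) \<longrightarrow> f Xs z = 0)) \<and>
        (2 \<le> p \<and> (fst (last Xs) = z \<or> snd (last Xs) = z) \<longrightarrow> f Xs z = 0))}"

definition omit :: "nat \<Rightarrow> 'b list \<Rightarrow> 'b list" where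
  "omit i Xs = take i Xs @ drop (Suc i) Xs"

text \<open>
  The coboundary of a \<open>p\<close>-cochain. Arguments are indexed from 0, hence \<open>X\<^sub>i\<^sub>+\<^sub>1 = (x i, y i)\<close> and the signs
  are shifted by one against the usual numbering. The term with \<open>[X\<^sub>i, X\<^sub>k]\<^sub>F\<close> is expanded into the two
  decomposable summands \<open>[x\<^sub>i, y\<^sub>i, x\<^sub>k] \<and> y\<^sub>k\<close> and \<open>x\<^sub>k \<and> [x\<^sub>i, y\<^sub>i, y\<^sub>k]\<close>.
\<close>

definition coboundary ::
  "('a \<Rightarrow> 'a \<Rightarrow> 'a \<Rightarrow> 'a) \<Rightarrow> ('k::field \<Rightarrow> 'v \<Rightarrow> 'v) \<Rightarrow> ('a \<Rightarrow> 'a \<Rightarrow> 'v \<Rightarrow> 'v) \<Rightarrow> nat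
     \<Rightarrow> ('a::ab_group_add, 'v::ab_group_add) cochain \<Rightarrow> ('a, 'v) cochain" where
  "coboundary br scaleV rho p f Xs z =
     (if length Xs = p then
        let x = (\<lambda>i. fst (Xs ! i)); y = (\<lambda>i. snd (Xs ! i)) in
          (\<Sum>k<p. \<Sum>i<k. scaleV ((-1) ^ (i + 1))
             (f (omit i (Xs[k := (br (x i) (y i) (x k), y k)])) z
              + f (omit i (Xs[k := (x k, br (x i) (y i) (y k))])) z))
          + (\<Sum>i<p. scaleV ((-1) ^ (i + 1)) (f (omit i Xs) (br (x i) (y i) z)))
          + (\<Sum>i<p. scaleV ((-1) ^ i) (rho (x i) (y i) (f (omit i Xs) z)))
          + scaleV ((-1) ^ (p + 1))
              (rho (y (p - 1)) z (f (butlast Xs) (x (p - 1)))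
               + rho z (x (p - 1)) (f (butlast Xs) (y (p - 1))))
      else 0)"

text \<open>
  The flat positions of \<open>x\<^sub>1, y\<^sub>1, \<dots>, x\<^sub>n, y\<^sub>n, z\<close> are \<open>0, \<dots>, 2 * n\<close>; \<open>apply_at R T f\<close> evaluates \<open>f\<close>
  with \<open>R\<close> applied exactly at the positions in \<open>T\<close>.
\<close>

definition apply_at ::
  "('a \<Rightarrow> 'a) \<Rightarrow> nat set \<Rightarrow> ('a, 'v) cochain \<Rightarrow> ('a, 'v) cochain" where
  "apply_at R T f Xs z =
     (let r = (\<lambda>j t. if j \<in> T then R t else t); n = length Xs in
        f (map (\<lambda>i. (r (2 * i) (fst (Xs ! i)), r (2 * i + 1) (snd (Xs ! i)))) [0..<n])
          (r (2 * n) z))"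

definition partial_R ::
  "('a \<Rightarrow> 'a) \<Rightarrow> nat \<Rightarrow> nat \<Rightarrow> ('a, 'v::ab_group_add) cochain \<Rightarrow> ('a, 'v) cochain" where
  "partial_R R n k f Xs z =
     (\<Sum>T | T \<subseteq> {..<2 * n + 1} \<and> card T = k. apply_at R T f Xs z)"

text \<open>\<open>delta\<close> at index \<open>n\<close> acts on \<open>(n + 1)\<close>-cochains.\<close>

definition delta ::
  "('k::field \<Rightarrow> 'v \<Rightarrow> 'v) \<Rightarrow> 'k \<Rightarrow> ('a \<Rightarrow> 'a) \<Rightarrow> ('v \<Rightarrow> 'v) \<Rightarrow> nat
     \<Rightarrow> ('a, 'v::ab_group_add) cochain \<Rightarrow> ('a, 'v) cochain" where
  "delta scaleV lam R RV n f Xs z =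
     (if length Xs = n then
        f (map (map_prod R R) Xs) (R z)
        - RV (\<Sum>k\<le>2 * n. scaleV (lam ^ (2 * n - k)) (partial_R R n k f Xs z))
      else 0)"

text \<open>
  In degree 1 there is no second component; it is represented by the zero function.
  The space of cochains of \<open>A\<^sub>R\<close> with values in \<open>V\<close> with its modified action depends only on the
  underlying vector spaces.
\<close>

definition RB_cochains ::
  "('k::field \<Rightarrow> 'a \<Rightarrow> 'a) \<Rightarrow> ('k \<Rightarrow> 'v \<Rightarrow> 'v) \<Rightarrow> nat
     \<Rightarrow> (('a::ab_group_add, 'v::ab_group_add) cochain \<times> ('a, 'v) cochain) set" where
  "RB_cochains scaleA scaleV n =
     cochains scaleA scaleV n
       \<times> (if n = 1 then {\<lambda>_ _. 0} else cochains scaleA scaleV (n - 1))"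

definition RB_coboundary ::
  "('k::field \<Rightarrow> 'a \<Rightarrow> 'a) \<Rightarrow> ('a \<Rightarrow> 'a \<Rightarrow> 'a \<Rightarrow> 'a) \<Rightarrow> 'k \<Rightarrow> ('a \<Rightarrow> 'a)
     \<Rightarrow> ('k \<Rightarrow> 'v \<Rightarrow> 'v) \<Rightarrow> ('a \<Rightarrow> 'a \<Rightarrow> 'v \<Rightarrow> 'v) \<Rightarrow> ('v \<Rightarrow> 'v) \<Rightarrow> nat
     \<Rightarrow> ('a::ab_group_add, 'v::ab_group_add) cochain \<times> ('a, 'v) cochain
     \<Rightarrow> ('a, 'v) cochain \<times> ('a, 'v) cochain" where
  "RB_coboundary scaleA br lam R scaleV rho RV n = (\<lambda>(f, g).
     (coboundary br scaleV rho n f,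
      \<lambda>Xs z.
        (if n = 1 then 0
         else coboundary (br_RB scaleA br lam R) scaleV (rho_RB scaleV rho lam R RV) (n - 1) g Xs z)
        + scaleV ((-1) ^ n) (delta scaleV lam R RV (n - 1) f Xs z)))"

end

theory Submission
  imports Defs "HOL-Library.Product_Plus"
begin

text \<open>
  The square of \<open>\<partial>\<^sub>R\<^sub>B\<close> has the components \<open>\<partial>\<partial>f\<close> and \<open>\<partial>\<^sub>R\<partial>\<^sub>Rg \<plusminus> (\<partial>\<^sub>R\<delta>f - \<delta>\<partial>f)\<close>, so the theorem amounts to
  three facts: \<open>\<partial>\<partial> = 0\<close> for every 3-Lie algebra and representation, \<open>A\<^sub>R\<close> and \<open>V\<close> with its modified
  action again are such a pair, and \<open>\<delta>\<close> is a chain map.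

  For \<open>\<partial>\<partial> = 0\<close>, the coboundary is put in a recursive form that is a Cartan formula. Let \<open>\<iota>\<^sub>X\<close> insert
  \<open>X = x \<and> y\<close> as first argument and let \<open>L\<^sub>X\<close> be the Lie derivative. Splitting off the summands that move
  the first argument gives \<open>\<iota>\<^sub>X\<partial> = L\<^sub>X - \<partial>\<iota>\<^sub>X\<close> on cochains of degree at least 2, and by definition
  \<open>L\<^sub>X\<iota>\<^sub>Y - \<iota>\<^sub>YL\<^sub>X = \<iota>\<^bsub>[X,Y]\<^esub>\<close>. From the fundamental identity follow \<open>[L\<^sub>X, L\<^sub>Y] = L\<^bsub>[X,Y]\<^esub>\<close>
  (\<open>LD_commutator\<close>) and then \<open>L\<^sub>X\<partial> = \<partial>L\<^sub>X\<close> (\<open>LD_CB_commute\<close>), whence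
  \<open>\<iota>\<^sub>X\<partial>\<partial> = L\<^sub>X\<partial> - \<partial>L\<^sub>X + \<partial>\<partial>\<iota>\<^sub>X = \<partial>\<partial>\<iota>\<^sub>X\<close> and induction on the number of arguments ends at a direct computation
  (\<open>CB_squared\<close>).

  For the Rota-Baxter part, extend scalars to \<open>k[t]/(t\<^sup>2 - \<lambda>t)\<close>. The map \<open>R + t\<close> satisfies
  \<open>[(R + t)x, (R + t)y, (R + t)z] = (R + t)[x, y, z]\<^sub>R\<close>: the constant term of this identity is the
  Rota-Baxter identity and its coefficient of \<open>t\<close> is the definition of \<open>[x, y, z]\<^sub>R\<close>. So \<open>A\<^sub>R\<close> acts on
  \<open>V[t] = V \<oplus> tV\<close> through \<open>R + t\<close>, and evaluating a cochain at the arguments \<open>(R + t)x\<^sub>i\<close> is a chain map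
  from cochains of \<open>A\<close> with values in \<open>V\<close> to cochains of \<open>A\<^sub>R\<close> with values in \<open>V[t]\<close>
  (\<open>CT_eval_shift\<close>); this again follows by induction from the Cartan formula. The compatibility
  condition on \<open>R\<^sub>V\<close> says exactly that \<open>v + tw \<mapsto> v - R\<^sub>Vw\<close> intertwines the action on \<open>V[t]\<close> with the
  modified action on \<open>V\<close> (\<open>rhoR_eval_RV\<close>). Finally
  \<open>f((R + t)x\<^sub>1, \<dots>) = f(Rx\<^sub>1, \<dots>) + t \<Sum>\<^sub>k \<lambda>\<^bsup>2n-k\<^esup> f\<^sup>k(x\<^sub>1, \<dots>)\<close> because \<open>t\<^bsup>j+1\<^esup> = \<lambda>\<^bsup>j\<^esup>t\<close>, so \<open>\<delta>\<close> is the
  composite of these two chain maps.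

  All operators are first treated on functions of argument lists of arbitrary length. A cochain vanishes
  on lists of the wrong length, so multilinearity and alternation can be required for all lists at once,
  and no degree has to be carried through the inductions.
\<close>


section \<open>Cartan calculus on functions of argument lists\<close>

definition contract :: "'a \<times> 'a \<Rightarrow> ('a, 'v) cochain \<Rightarrow> ('a, 'v) cochain" where
  "contract X f Xs z = f (X # Xs) z"

text \<open>
  The second equation is the identity \<open>\<iota>\<^sub>YL\<^sub>X = L\<^sub>X\<iota>\<^sub>Y - \<iota>\<^bsub>[X,Y]\<^esub>\<close>, where \<open>[X,Y]\<close> is the sum of two
  decomposable elements; it replaces a sum over all argument positions.
\<close>

fun lie_deriv ::
  "('a \<Rightarrow> 'a \<Rightarrow> 'a \<Rightarrow> 'a) \<Rightarrow> ('a \<Rightarrow> 'a \<Rightarrow> 'v \<Rightarrow> 'v) \<Rightarrow> 'a \<times> 'a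
     \<Rightarrow> ('a, 'v::ab_group_add) cochain \<Rightarrow> ('a, 'v) cochain" where
  "lie_deriv br rho X f [] z = rho (fst X) (snd X) (f [] z) - f [] (br (fst X) (snd X) z)"
| "lie_deriv br rho X f (Y # Ys) z = lie_deriv br rho X (contract Y f) Ys z
     - f ((br (fst X) (snd X) (fst Y), snd Y) # Ys) z
     - f ((fst Y, br (fst X) (snd X) (snd Y)) # Ys) z"

text \<open>
  The recursion \<open>\<iota>\<^sub>X\<partial> = L\<^sub>X - \<partial>\<iota>\<^sub>X\<close> starts at functions of one element of \<open>A\<close>, where the two summands
  with the action of \<open>y \<and> z\<close> and \<open>z \<and> x\<close> enter. The value on the empty list is a dummy: a coboundary has
  at least one argument pair.
\<close>

fun cartan_coboundary ::
  "('a \<Rightarrow> 'a \<Rightarrow> 'a \<Rightarrow> 'a) \<Rightarrow> ('a \<Rightarrow> 'a \<Rightarrow> 'v \<Rightarrow> 'v)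
     \<Rightarrow> ('a, 'v::ab_group_add) cochain \<Rightarrow> ('a, 'v) cochain" where
  "cartan_coboundary br rho f [] z = 0"
| "cartan_coboundary br rho f [X] z = rho (fst X) (snd X) (f [] z) - f [] (br (fst X) (snd X) z)
     + rho (snd X) z (f [] (fst X)) + rho z (fst X) (f [] (snd X))"
| "cartan_coboundary br rho f (X # Y # Ys) z =
     lie_deriv br rho X f (Y # Ys) z - cartan_coboundary br rho (contract X f) (Y # Ys) z"

lemma lie_deriv_cong:
  assumes "\<And>Ws w. length Ws = length Ys \<Longrightarrow> f Ws w = g Ws w"
  shows "lie_deriv br rho X f Ys z = lie_deriv br rho X g Ys z"
  using assms
proof (induction Ys arbitrary: f g)
  case (Cons Y Ys)
  have "lie_deriv br rho X (contract Y f) Ys z = lie_deriv br rho X (contract Y g) Ys z"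
    using Cons.prems by (intro Cons.IH) (simp add: contract_def)
  with Cons.prems show ?case by simp
qed simp

lemma cartan_coboundary_cong:
  assumes "\<And>Ws w. Suc (length Ws) = length Ys \<Longrightarrow> f Ws w = g Ws w"
  shows "cartan_coboundary br rho f Ys z = cartan_coboundary br rho g Ys z"
  using assms
proof (induction Ys arbitrary: f g rule: induct_list012)
  case (3 X Y Ys)
  have "cartan_coboundary br rho (contract X f) (Y # Ys) z = cartan_coboundary br rho (contract X g) (Y # Ys) z"
    using 3 by (intro 3) (simp_all add: contract_def)
  moreover have "lie_deriv br rho X f (Y # Ys) z = lie_deriv br rho X g (Y # Ys) z"
    using 3 by (intro lie_deriv_cong) simp
  ultimately show ?case by simp
qed simp_all

text \<open>
  An intertwiner of two actions of the same bracket commutes with the whole calculus. This serves for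
  scalars, for multiplication by \<open>t\<close> on \<open>V[t]\<close> and for the evaluation from \<open>V[t]\<close> to \<open>V\<close>.
\<close>

lemma lie_deriv_intertwine:
  assumes add: "\<And>u v. T (u + v) = T u + T v"
    and comm: "\<And>x y v. rho' x y (T v) = T (rho x y v)"
  shows "lie_deriv br rho' X (\<lambda>Ws w. T (f Ws w)) Ys z = T (lie_deriv br rho X f Ys z)"
proof (induction Ys arbitrary: f)
  interpret additive T by standard (rule add)
  {
    case Nil
    show ?case by (simp add: comm diff)
  next
    case (Cons Y Ys)
    have "contract Y (\<lambda>Ws w. T (f Ws w)) = (\<lambda>Ws w. T (contract Y f Ws w))"
      by (simp add: contract_def fun_eq_iff)
    then show ?case by (simp add: Cons.IH diff)
  }
qed

lemma cartan_coboundary_intertwine: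
  assumes add: "\<And>u v. T (u + v) = T u + T v"
    and comm: "\<And>x y v. rho' x y (T v) = T (rho x y v)"
  shows "cartan_coboundary br rho' (\<lambda>Ws w. T (f Ws w)) Ys z = T (cartan_coboundary br rho f Ys z)"
proof (induction Ys arbitrary: f rule: induct_list012)
  interpret additive T by standard (rule add)
  {
    case 1 show ?case by (simp add: zero)
  next
    case 2 show ?case by (simp add: comm diff add)
  next
    case (3 X Y Ys)
    have "contract X (\<lambda>Ws w. T (f Ws w)) = (\<lambda>Ws w. T (contract X f Ws w))"
      by (simp add: contract_def fun_eq_iff)
    with 3 show ?case
      by (simp add: lie_deriv_intertwine[of T rho' rho, OF add comm] diff del: lie_deriv.simps)
  }
qed

lemma lie_deriv_add:
  assumes add: "\<And>x y u v. rho x y (u + v) = rho x y u + rho x y v"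
  shows "lie_deriv br rho X (\<lambda>Ws w. f Ws w + g Ws w) Ys z
           = lie_deriv br rho X f Ys z + lie_deriv br rho X g Ys z"
proof (induction Ys arbitrary: f g)
  case (Cons Y Ys)
  have "contract Y (\<lambda>Ws w. f Ws w + g Ws w) = (\<lambda>Ws w. contract Y f Ws w + contract Y g Ws w)"
    by (simp add: contract_def fun_eq_iff)
  then show ?case by (simp add: Cons.IH algebra_simps)
qed (simp add: add)

lemma cartan_coboundary_add:
  assumes add: "\<And>x y u v. rho x y (u + v) = rho x y u + rho x y v"
  shows "cartan_coboundary br rho (\<lambda>Ws w. f Ws w + g Ws w) Ys z
           = cartan_coboundary br rho f Ys z + cartan_coboundary br rho g Ys z"
proof (induction Ys arbitrary: f g rule: induct_list012)
  case (3 X Y Ys)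
  have "contract X (\<lambda>Ws w. f Ws w + g Ws w) = (\<lambda>Ws w. contract X f Ws w + contract X g Ws w)"
    by (simp add: contract_def fun_eq_iff)
  with 3 show ?case
    by (simp add: lie_deriv_add[of rho, OF add] del: lie_deriv.simps)
qed (simp_all add: add)

lemma lie_deriv_diff:
  assumes add: "\<And>x y u v. rho x y (u + v) = rho x y u + rho x y v"
  shows "lie_deriv br rho X (\<lambda>Ws w. f Ws w - g Ws w) Ys z
           = lie_deriv br rho X f Ys z - lie_deriv br rho X g Ys z"
  using lie_deriv_add[of rho br X "\<lambda>Ws w. f Ws w - g Ws w" g Ys z, OF add]
  by (simp add: algebra_simps)

lemma cartan_coboundary_diff:
  assumes add: "\<And>x y u v. rho x y (u + v) = rho x y u + rho x y v"
  shows "cartan_coboundary br rho (\<lambda>Ws w. f Ws w - g Ws w) Ys z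
           = cartan_coboundary br rho f Ys z - cartan_coboundary br rho g Ys z"
  using cartan_coboundary_add[of rho br "\<lambda>Ws w. f Ws w - g Ws w" g Ys z, OF add]
  by (simp add: algebra_simps)

text \<open>
  Membership in a cochain space is split into its support, which fixes the degree, and the following two
  conditions, which do not mention the degree and hence pass to \<open>\<iota>\<^sub>Xf\<close> without change.
\<close>

definition multilinear ::
  "('k::field \<Rightarrow> 'a \<Rightarrow> 'a) \<Rightarrow> ('k \<Rightarrow> 'v \<Rightarrow> 'v)
     \<Rightarrow> ('a::ab_group_add, 'v::ab_group_add) cochain \<Rightarrow> bool" where
  "multilinear scaleA scaleV f \<longleftrightarrow>
     (\<forall>Xs. Vector_Spaces.linear scaleA scaleV (f Xs)) \<and>
     (\<forall>Xs y Ys z. Vector_Spaces.linear scaleA scaleV (\<lambda>x. f (Xs @ (x, y) # Ys) z)) \<and>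
     (\<forall>Xs x Ys z. Vector_Spaces.linear scaleA scaleV (\<lambda>y. f (Xs @ (x, y) # Ys) z))"

definition alternating :: "('a, 'v::ab_group_add) cochain \<Rightarrow> bool" where
  "alternating f \<longleftrightarrow>
     (\<forall>Xs x Ys z. f (Xs @ (x, x) # Ys) z = 0) \<and>
     (\<forall>Xs x z. f (Xs @ [(x, z)]) z = 0) \<and> (\<forall>Xs y z. f (Xs @ [(z, y)]) z = 0)"

lemma multilinear_contract:
  assumes "multilinear scaleA scaleV f" shows "multilinear scaleA scaleV (contract X f)"
  using assms unfolding multilinear_def contract_def[abs_def] by (simp flip: append_Cons)

lemma alternating_contract:
  assumes "alternating f" shows "alternating (contract X f)"
  using assms unfolding alternating_def contract_def by (simp flip: append_Cons)

context three_lie_representation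
begin

abbreviation lin :: "('a \<Rightarrow> 'v) \<Rightarrow> bool" where
  "lin \<equiv> Vector_Spaces.linear scaleA scaleV"

abbreviation ml :: "('a, 'v) cochain \<Rightarrow> bool" where
  "ml \<equiv> multilinear scaleA scaleV"

abbreviation LD where "LD \<equiv> lie_deriv br rho"
abbreviation CB where "CB \<equiv> cartan_coboundary br rho"

sublocale AV: vector_space_pair scaleA scaleV
  by unfold_locales

lemma lin_iff: "lin F \<longleftrightarrow> (\<forall>x y. F (x + y) = F x + F y) \<and> (\<forall>c x. F (scaleA c x) = scaleV c (F x))"
  using vector_space_axioms V.vector_space_axioms by (simp add: Vector_Spaces.linear_iff)

lemmas lin_intros = AV.linear_compose_add AV.linear_compose_sub AV.linear_compose_scale_right
  AV.linear_zero

lemma br_add: "br (x + x') y z = br x y z + br x' y z" "br x (y + y') z = br x y z + br x y' z"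
    "br x y (z + z') = br x y z + br x y z'"
  and br_scale: "br (scaleA c x) y z = scaleA c (br x y z)" "br x (scaleA c y) z = scaleA c (br x y z)"
    "br x y (scaleA c z) = scaleA c (br x y z)"
  using br_linear1[of y z] br_linear2[of x z] br_linear3[of x y]
  by (simp_all add: Vector_Spaces.linear_iff)

lemma rho_add: "rho (x + x') y v = rho x y v + rho x' y v" "rho x (y + y') v = rho x y v + rho x y' v"
    "rho x y (v + v') = rho x y v + rho x y v'"
  and rho_scale: "rho (scaleA c x) y v = scaleV c (rho x y v)" "rho x (scaleA c y) v = scaleV c (rho x y v)"
    "rho x y (scaleV c v) = scaleV c (rho x y v)"
  using rho_linear1[of y v] rho_linear2[of x v] rho_endo[of x y]
  by (simp_all add: Vector_Spaces.linear_iff)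

lemma rho_0: "rho 0 y v = 0" "rho x 0 v = 0" "rho x y 0 = 0"
  using rho_add(1)[of 0 0 y v] rho_add(2)[of x 0 0 v] rho_add(3)[of x y 0 0] by simp_all

lemma rho_diff: "rho x y (v - v') = rho x y v - rho x y v'"
  using rho_add(3)[of x y "v - v'" v'] by (simp add: algebra_simps)

lemma rho_uminus: "rho x y (- v) = - rho x y v"
  using rho_diff[of x y 0 v] by (simp add: rho_0)

lemma br_skew: "br y x z = - br x y z" "br x z y = - br x y z" "br z y x = - br x y z"
proof -
  have "br x x z + br y x z + (br x y z + br y y z) = br (x + y) (x + y) z"
    by (simp only: br_add)
  then show "br y x z = - br x y z"
    by (simp add: br_alt12 eq_neg_iff_add_eq_0)
  have "br x y y + br x z y + (br x y z + br x z z) = br x (y + z) (y + z)"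
    by (simp only: br_add)
  then show "br x z y = - br x y z"
    by (simp add: br_alt23 eq_neg_iff_add_eq_0)
  have "br x y x + br z y x + (br x y z + br z y z) = br (x + z) y (x + z)"
    by (simp only: br_add)
  then show "br z y x = - br x y z"
    by (simp add: br_alt13 eq_neg_iff_add_eq_0)
qed

lemma rho_skew: "rho y x v = - rho x y v"
proof -
  have "rho x x v + rho y x v + (rho x y v + rho y y v) = rho (x + y) (x + y) v"
    by (simp only: rho_add)
  then show ?thesis
    by (simp add: rho_alt eq_neg_iff_add_eq_0)
qed

lemma lin_rho: "lin F \<Longrightarrow> lin (\<lambda>x. rho a b (F x))"
  by (simp add: lin_iff rho_add rho_scale)

lemma lin_br: "lin F \<Longrightarrow> lin (\<lambda>x. F (br a b x))"
  by (simp add: lin_iff br_add br_scale)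

lemma ml_lin:
  assumes "ml f"
  shows "lin (f Xs)" "lin (\<lambda>x. f ((x, y) # Xs) z)" "lin (\<lambda>y. f ((x, y) # Xs) z)"
    and "lin (\<lambda>x. f (Ys @ (x, y) # Xs) z)" "lin (\<lambda>y. f (Ys @ (x, y) # Xs) z)"
  using assms unfolding multilinear_def by (auto dest: spec[of _ "[]"])
 
lemma ml_add:
  assumes "ml f"
  shows "f Xs (z + z') = f Xs z + f Xs z'"
    "f ((x + x', y) # Xs) z = f ((x, y) # Xs) z + f ((x', y) # Xs) z"
    "f ((x, y + y') # Xs) z = f ((x, y) # Xs) z + f ((x, y') # Xs) z"
  using ml_lin(1-3)[OF assms] by (simp_all add: lin_iff)

lemma ml_scale:
  assumes "ml f"
  shows "f Xs (scaleA c z) = scaleV c (f Xs z)"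
    "f ((scaleA c x, y) # Xs) z = scaleV c (f ((x, y) # Xs) z)"
    "f ((x, scaleA c y) # Xs) z = scaleV c (f ((x, y) # Xs) z)"
  using ml_lin(1-3)[OF assms] by (simp_all add: lin_iff)

lemma ml_0:
  assumes "ml f"
  shows "f Xs 0 = 0" "f ((0, y) # Xs) z = 0" "f ((x, 0) # Xs) z = 0"
  using ml_scale[OF assms, where c = 0] by simp_all

section \<open>The square of the coboundary\<close>

lemma LD_add: "LD X (\<lambda>Ws w. f Ws w + g Ws w) Ys z = LD X f Ys z + LD X g Ys z"
  by (rule lie_deriv_add) (rule rho_add)

lemma LD_diff: "LD X (\<lambda>Ws w. f Ws w - g Ws w) Ys z = LD X f Ys z - LD X g Ys z"
  by (rule lie_deriv_diff) (rule rho_add)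

lemma CB_add: "CB (\<lambda>Ws w. f Ws w + g Ws w) Ys z = CB f Ys z + CB g Ys z"
  by (rule cartan_coboundary_add) (rule rho_add)

lemma CB_diff: "CB (\<lambda>Ws w. f Ws w - g Ws w) Ys z = CB f Ys z - CB g Ys z"
  by (rule cartan_coboundary_diff) (rule rho_add)

lemma contract_LD:
  "contract Y (LD X f) = (\<lambda>Ws w. LD X (contract Y f) Ws w
     - contract (br (fst X) (snd X) (fst Y), snd Y) f Ws w
     - contract (fst Y, br (fst X) (snd X) (snd Y)) f Ws w)"
  by (simp add: fun_eq_iff contract_def[of _ "LD X f"] contract_def[of "(_, _)"])

text \<open>
  Inserting \<open>Z\<close> into the commutator leaves, beside the induction hypothesis, the insertions of
  \<open>[Y,[X,Z]]\<close>, \<open>[X,[Y,Z]]\<close> and \<open>[[X,Y],Z]\<close>; these cancel since \<open>\<and>\<^sup>2A\<close> is a Leibniz algebra, which is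
  the fundamental identity applied in each slot of \<open>Z\<close>. On a function of one element the claim combines
  the fundamental identity with the commutator axiom of a representation.
\<close>

lemma LD_commutator:
  assumes "ml f"
  shows "LD X (LD Y f) Zs z - LD Y (LD X f) Zs z =
     LD (br (fst X) (snd X) (fst Y), snd Y) f Zs z + LD (fst Y, br (fst X) (snd X) (snd Y)) f Zs z"
  using assms
proof (induction Zs arbitrary: f)
  case Nil
  obtain a b where [simp]: "X = (a, b)" by force
  obtain c e where [simp]: "Y = (c, e)" by force
  have 1: "br a b (br c e z) = br (br a b c) e z + br c (br a b e) z + br c e (br a b z)"
    by (rule fundamental_identity)
  have 2: "rho a b (rho c e v) = rho c e (rho a b v) + rho (br a b c) e v + rho c (br a b e) v" for v
    using rho_commutator[of a b c e v] by (simp add: algebra_simps rho_skew[of "br a b e" c])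
  show ?case
    by (simp add: rho_diff 1 2 ml_add[OF Nil] algebra_simps)
next
  case (Cons Z Zs)
  obtain a b where [simp]: "X = (a, b)" by force
  obtain c e where [simp]: "Y = (c, e)" by force
  obtain z1 z2 where [simp]: "Z = (z1, z2)" by force
  have IH: "LD X (LD Y (contract Z f)) Zs z =
    LD Y (LD X (contract Z f)) Zs z + 
     LD (br a b c, e) (contract Z f) Zs z + LD (c, br a b e) (contract Z f) Zs z"
    using Cons.IH[OF multilinear_contract[OF Cons.prems]] by (simp add: algebra_simps)
  have 1: "br a b (br c e t) = br (br a b c) e t + br c (br a b e) t + br c e (br a b t)" for t
    by (rule fundamental_identity)
  have "LD X (LD Y f) (Z # Zs) z - LD Y (LD X f) (Z # Zs) z =
      LD X (LD Y (contract Z f)) Zs z - LD Y (LD X (contract Z f)) Zs z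
      - (f ((br a b (br c e z1), z2) # Zs) z - f ((br c e (br a b z1), z2) # Zs) z)
      - (f ((z1, br a b (br c e z2)) # Zs) z - f ((z1, br c e (br a b z2)) # Zs) z)"
    by (simp only: lie_deriv.simps contract_LD LD_diff) (simp add: contract_def[abs_def] algebra_simps)
  then show ?case using IH
    by (simp add: 1 ml_add[OF Cons.prems] contract_def[abs_def])
qed

lemma contract_CB:
  "Ws \<noteq> [] \<Longrightarrow> contract X (CB f) Ws w = LD X f Ws w - CB (contract X f) Ws w"
  by (cases Ws) (simp_all add: contract_def)

text \<open>
  The induction step is the chain
  \<open>\<iota>\<^sub>YL\<^sub>X\<partial> = L\<^sub>X\<iota>\<^sub>Y\<partial> - \<iota>\<^bsub>[X,Y]\<^esub>\<partial> = L\<^sub>XL\<^sub>Y - L\<^bsub>[X,Y]\<^esub> - \<partial>(L\<^sub>X\<iota>\<^sub>Y - \<iota>\<^bsub>[X,Y]\<^esub>) = L\<^sub>YL\<^sub>X - \<partial>\<iota>\<^sub>YL\<^sub>X = \<iota>\<^sub>Y\<partial>L\<^sub>X\<close>,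
  which uses the Cartan formula only in degrees at least 2; one argument pair is checked by expansion.
\<close>

lemma LD_CB_commute:
  assumes "ml f"
  shows "LD X (CB f) Ys z = CB (LD X f) Ys z"
  using assms
proof (induction Ys arbitrary: f rule: induct_list012)
  case 1
  show ?case by (simp add: rho_0)
next
  case (2 Y)
  obtain a b where [simp]: "X = (a, b)" by force
  obtain c e where [simp]: "Y = (c, e)" by force
  have 1: "br a b (br c e t) = br (br a b c) e t + br c (br a b e) t + br c e (br a b t)" for t
    by (rule fundamental_identity)
  have r: "rho a b (rho s t v) = rho s t (rho a b v) + rho (br a b s) t v + rho s (br a b t) v" for s t v
    using rho_commutator[of a b s t v] by (simp add: algebra_simps rho_skew[of "br a b t" s])
  show ?case 
    by (simp add: contract_def rho_diff rho_add 1 r ml_add[OF 2(1)] algebra_simps)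
next
  case (3 Y Y' Ys)
  let ?b = "br (fst X) (snd X)"
  have "LD X (CB f) (Y # Y' # Ys) z = LD X (contract Y (CB f)) (Y' # Ys) z 
      - contract (?b (fst Y), snd Y) (CB f) (Y' # Ys) z
      - contract (fst Y, ?b (snd Y)) (CB f) (Y' # Ys) z"
    by (simp add: contract_def)
  also have "LD X (contract Y (CB f)) (Y' # Ys) z
      = LD X (\<lambda>Ws w. LD Y f Ws w - CB (contract Y f) Ws w) (Y' # Ys) z"
    by (rule lie_deriv_cong) (auto intro: contract_CB)
  also have "\<dots> = LD X (LD Y f) (Y' # Ys) z - LD X (CB (contract Y f)) (Y' # Ys) z"
    by (rule LD_diff)
  also have "LD X (CB (contract Y f)) (Y' # Ys) z = CB (LD X (contract Y f)) (Y' # Ys) z"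
    using 3 multilinear_contract by blast
  finally have "LD X (CB f) (Y # Y' # Ys) z = LD Y (LD X f) (Y' # Ys) z
      - (CB (LD X (contract Y f)) (Y' # Ys) z - CB (contract (?b (fst Y), snd Y) f) (Y' # Ys) z
        - CB (contract (fst Y, ?b (snd Y)) f) (Y' # Ys) z)"
    using LD_commutator[OF 3(3), of X Y "Y' # Ys" z] 
    by (simp add: contract_CB algebra_simps del: lie_deriv.simps)
  also have "\<dots> = LD Y (LD X f) (Y' # Ys) z - CB (contract Y (LD X f)) (Y' # Ys) z"
    by (simp only: contract_LD CB_diff)
  also have "\<dots> = CB (LD X f) (Y # Y' # Ys) z"
    by simp
  finally show ?case .
qed

text \<open>
  With three or more argument pairs, \<open>\<iota>\<^sub>X\<partial>\<partial> = \<partial>\<partial>\<iota>\<^sub>X\<close> reduces the claim to shorter lists. With two pairs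
  the Cartan formula for \<open>\<iota>\<^sub>X\<partial>f\<close> has the extra summand \<open>\<psi>(z) = \<rho>(b,z)f(a) + \<rho>(z,a)f(b)\<close>, where
  \<open>X = a \<and> b\<close>; it is a cocycle by the second axiom of a representation.
\<close>

lemma CB_squared:
  assumes "ml f"
  shows "CB (CB f) Xs z = 0"
  using assms
proof (induction Xs arbitrary: f rule: induct_list012)
  case (2 X)
  then show ?case by (simp add: rho_0)
next
  case (3 X Y Ys)
  show ?case
  proof (cases Ys)
    case Nil
    obtain a b where [simp]: "X = (a, b)" by force
    obtain c e where [simp]: "Y = (c, e)" by force
    let ?\<psi> = "\<lambda>Ws :: ('a \<times> 'a) list. \<lambda>w. rho b w (f [] a) + rho w a (f [] b)"
    have "CB (contract X (CB f)) [Y] z = CB (\<lambda>Ws w. LD X f Ws w + ?\<psi> Ws w) [Y] z"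
      by (rule cartan_coboundary_cong) (auto simp: contract_def)
    also have "\<dots> = CB (LD X f) [Y] z + CB ?\<psi> [Y] z"
      by (rule CB_add)
    also have "CB ?\<psi> [Y] z = 0"
      using rho_bracket[of c e z b "f [] a"] rho_bracket[of c e z a "f [] b"]
      by (simp add: rho_add rho_diff rho_uminus algebra_simps
          rho_skew[of b "br c e z"] rho_skew[of b z] rho_skew[of b c] rho_skew[of b e])
    finally show ?thesis unfolding Nil using LD_CB_commute[OF 3(3), of X "[Y]" z] by simp
  next
    case (Cons Y' Zs)
    let ?Ys = "Y # Y' # Zs"
    have "CB (contract X (CB f)) ?Ys z = CB (\<lambda>Ws w. LD X f Ws w - CB (contract X f) Ws w) ?Ys z"
      by (rule cartan_coboundary_cong) (auto intro!: contract_CB)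
    also have "\<dots> = CB (LD X f) ?Ys z - CB (CB (contract X f)) ?Ys z"
      by (rule CB_diff)
    also have "CB (CB (contract X f)) ?Ys z = 0"
      using 3(2)[OF multilinear_contract[OF 3(3)]] Cons by simp
    finally have "CB (contract X (CB f)) ?Ys z = LD X (CB f) ?Ys z"
      by (simp only: diff_zero LD_CB_commute[OF 3(3)])
    moreover have "CB (CB f) (X # ?Ys) z = LD X (CB f) ?Ys z - CB (contract X (CB f)) ?Ys z"
      by (rule cartan_coboundary.simps(3))
    ultimately show ?thesis by (simp only: Cons diff_self)
  qed
qed simp

section \<open>The coboundary preserves cochains\<close>

text \<open>
  \<open>L\<^sub>X\<close> and \<open>\<partial>\<close> are linear in the cochain, so they keep linear dependence on a parameter. Through this,
  linearity of \<open>\<partial>f\<close> in its first argument pair is reduced to linearity of \<open>\<iota>\<^sub>Xf\<close> in \<open>X\<close>.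
\<close>

lemma lin_LD_param:
  assumes "\<And>Zs z. lin (\<lambda>t. F t Zs z)"
  shows "lin (\<lambda>t. LD X (F t) Ys z)"
  using assms
proof (induction Ys arbitrary: F)
  case Nil
  then show ?case by (auto intro!: lin_intros lin_rho)
next
  case (Cons Y Ys)
  have "lin (\<lambda>t. LD X (contract Y (F t)) Ys z)"
    by (intro Cons.IH) (simp add: contract_def Cons.prems)
  then show ?case by (auto intro!: lin_intros Cons.prems)
qed

lemma lin_CB_param:
  assumes "\<And>Zs z. lin (\<lambda>t. F t Zs z)"
  shows "lin (\<lambda>t. CB (F t) Ys z)"
  using assms
proof (induction Ys arbitrary: F rule: induct_list012)
  case (3 X Y Ys)
  have "lin (\<lambda>t. CB (contract X (F t)) (Y # Ys) z)"
    by (intro 3) (simp add: contract_def 3)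
  moreover have "lin (\<lambda>t. LD X (F t) (Y # Ys) z)"
    by (intro lin_LD_param 3)
  ultimately show ?case
    by (simp add: lin_intros del: lie_deriv.simps)
qed (auto intro!: lin_intros lin_rho)

lemma ml_LD:
  assumes "ml f" shows "ml (LD X f)"
proof -
  obtain a b where X: "X = (a, b)" by force
  have 1: "lin (LD X f Xs)" if "ml f" for f Xs
    using that
  proof (induction Xs arbitrary: f)
    case Nil
    have "lin (\<lambda>z. rho a b (f [] z) - f [] (br a b z))"
      by (intro lin_intros lin_rho lin_br ml_lin Nil)
    then show ?case by (simp add: X)
  next
    case (Cons Y Ys)
    have "lin (\<lambda>z. LD X (contract Y f) Ys z)"
      using Cons multilinear_contract by blast
    then have "lin (\<lambda>z. LD X (contract Y f) Ys z - f ((br a b (fst Y), snd Y) # Ys) z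
        - f ((fst Y, br a b (snd Y)) # Ys) z)"
      by (simp add: lin_intros ml_lin Cons.prems)
    then show ?case by (simp add: X)
  qed
  have 2: "lin (\<lambda>x. LD X f (Xs @ (x, y) # Ys) z)" if "ml f" for f Xs y Ys z
    using that
  proof (induction Xs arbitrary: f)
    case Nil
    have "lin (\<lambda>x. LD X (contract (x, y) f) Ys z)"
      by (rule lin_LD_param) (simp add: contract_def ml_lin[OF Nil])
    moreover have "lin (\<lambda>x. f ((br a b x, y) # Ys) z)"
      using lin_br[OF ml_lin(2)[OF Nil]] .
    ultimately show ?case
      by (simp add: lin_intros ml_lin(2,3)[OF Nil] X)
  next
    case (Cons Y Xs)
    have "lin (\<lambda>x. LD X (contract Y f) (Xs @ (x, y) # Ys) z)"
      using Cons multilinear_contract by blast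
    moreover have "lin (\<lambda>x. f (W # Xs @ (x, y) # Ys) z)" for W
      using ml_lin(4)[OF Cons.prems, of "W # Xs"] by simp
    ultimately show ?case by (auto intro!: lin_intros)
  qed
  have 3: "lin (\<lambda>y. LD X f (Xs @ (x, y) # Ys) z)" if "ml f" for f Xs x Ys z
    using that
  proof (induction Xs arbitrary: f)
    case Nil
    have "lin (\<lambda>y. LD X (contract (x, y) f) Ys z)"
      by (rule lin_LD_param) (simp add: contract_def ml_lin[OF Nil])
    moreover have "lin (\<lambda>y. f ((x, br a b y) # Ys) z)"
      using lin_br[OF ml_lin(3)[OF Nil]] .
    ultimately show ?case
      by (simp add: lin_intros ml_lin(2,3)[OF Nil] X)
  next
    case (Cons Y Xs)
    have "lin (\<lambda>y. LD X (contract Y f) (Xs @ (x, y) # Ys) z)"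
      using Cons multilinear_contract by blast
    moreover have "lin (\<lambda>y. f (W # Xs @ (x, y) # Ys) z)" for W
      using ml_lin(5)[OF Cons.prems, of "W # Xs"] by simp
    ultimately show ?case by (auto intro!: lin_intros)
  qed
  show ?thesis using assms by (auto simp: multilinear_def[of _ _ "LD X f"] intro: 1 2 3)
qed

lemma lin_LD_direction:
  assumes "ml f"
  shows "lin (\<lambda>x. LD (x, y) f Ys z)" "lin (\<lambda>y. LD (x, y) f Ys z)"
proof -
  have F: "lin G \<Longrightarrow> lin (\<lambda>x. G (br x y z))" "lin G \<Longrightarrow> lin (\<lambda>y. G (br x y z))" for G x y z
    by (simp_all add: lin_iff br_add br_scale)
  have R: "lin (\<lambda>x. rho x y v)" "lin (\<lambda>y. rho x y v)" for x y v
    by (simp_all add: lin_iff rho_add rho_scale)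
  show "lin (\<lambda>x. LD (x, y) f Ys z)" using assms
  proof (induction Ys arbitrary: f)
    case Nil
    then show ?case using F(1)[OF ml_lin(1)[OF Nil]] by (auto intro!: lin_intros R)
  next
    case (Cons Y Ys)
    obtain a b where Y: "Y = (a, b)" by force
    show ?case unfolding Y
      using Cons.IH[OF multilinear_contract[OF Cons.prems]]
        F(1)[OF ml_lin(2)[OF Cons.prems]] F(1)[OF ml_lin(3)[OF Cons.prems]]
      by (auto intro!: lin_intros)
  qed
  show "lin (\<lambda>y. LD (x, y) f Ys z)" using assms
  proof (induction Ys arbitrary: f)
    case Nil
    then show ?case using F(2)[OF ml_lin(1)[OF Nil]] by (auto intro!: lin_intros R)
  next
    case (Cons Y Ys)
    obtain a b where Y: "Y = (a, b)" by force
    show ?case unfolding Y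
      using Cons.IH[OF multilinear_contract[OF Cons.prems]]
        F(2)[OF ml_lin(2)[OF Cons.prems]] F(2)[OF ml_lin(3)[OF Cons.prems]]
      by (auto intro!: lin_intros)
  qed
qed

lemma ml_CB:
  assumes "ml f" shows "ml (CB f)"
proof -
  have F: "lin G \<Longrightarrow> lin (\<lambda>x. G (br x y z))" "lin G \<Longrightarrow> lin (\<lambda>y. G (br x y z))" for G x y z
    by (simp_all add: lin_iff br_add br_scale)
  have R: "lin (\<lambda>x. rho x y v)" "lin (\<lambda>y. rho x y v)" for x y v
    by (simp_all add: lin_iff rho_add rho_scale)
  have 1: "lin (CB f Xs)" if "ml f" for f Xs
    using that
  proof (induction Xs arbitrary: f rule: induct_list012)
    case 1
    have "lin (\<lambda>z. 0)" by (rule lin_intros)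
    then show ?case by (simp cong: if_cong)
  next
    case (2 X)
    obtain a b where X: "X = (a, b)" by force
    have "lin (\<lambda>z. rho a b (f [] z) - f [] (br a b z) + rho b z (f [] a) + rho z a (f [] b))"
      by (intro lin_intros lin_rho lin_br ml_lin R 2)
    then show ?case by (simp add: X)
  next
    case (3 X Y Ys)
    have "lin (\<lambda>z. LD X f (Y # Ys) z - CB (contract X f) (Y # Ys) z)"
      by (intro lin_intros 3 multilinear_contract ml_lin ml_LD)
    then show ?case by simp
  qed
  have 2: "lin (\<lambda>x. CB f (Xs @ (x, y) # Ys) z)" if "ml f" for f Xs y Ys z
    using that
  proof (induction Xs arbitrary: f)
    case Nil
    show ?case
    proof (cases Ys)
      case N: Nil
      have "lin (\<lambda>x. rho x y (f [] z) - f [] (br x y z) + rho y z (f [] x) + rho z x (f [] y))"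
        by (intro lin_intros F lin_rho R ml_lin Nil)
      then show ?thesis by (simp add: N)
    next
      case (Cons Y Zs)
      have "lin (\<lambda>x. LD (x, y) f Ys z - CB (contract (x, y) f) Ys z)"
        by (intro lin_intros lin_LD_direction lin_CB_param Nil) (simp add: contract_def ml_lin[OF Nil])
      then show ?thesis by (simp add: Cons)
    qed
  next
    case (Cons Y Xs)
    have "lin (\<lambda>x. LD Y f (Xs @ (x, y) # Ys) z - CB (contract Y f) (Xs @ (x, y) # Ys) z)"
      by (intro lin_intros Cons.IH multilinear_contract ml_lin ml_LD Cons.prems)
    then show ?case by (cases Xs) simp_all
  qed
  have 3: "lin (\<lambda>y. CB f (Xs @ (x, y) # Ys) z)" if "ml f" for f Xs x Ys z
    using that
  proof (induction Xs arbitrary: f)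
    case Nil
    show ?case
    proof (cases Ys)
      case N: Nil
      have "lin (\<lambda>y. rho x y (f [] z) - f [] (br x y z) + rho y z (f [] x) + rho z x (f [] y))"
        by (intro lin_intros F lin_rho R ml_lin Nil)
      then show ?thesis by (simp add: N)
    next
      case (Cons Y Zs)
      have "lin (\<lambda>y. LD (x, y) f Ys z - CB (contract (x, y) f) Ys z)"
        by (intro lin_intros lin_LD_direction lin_CB_param Nil) (simp add: contract_def ml_lin[OF Nil])
      then show ?thesis by (simp add: Cons)
    qed
  next
    case (Cons Y Xs)
    have "lin (\<lambda>y. LD Y f (Xs @ (x, y) # Ys) z - CB (contract Y f) (Xs @ (x, y) # Ys) z)"
      by (intro lin_intros Cons.IH multilinear_contract ml_lin ml_LD Cons.prems)
    then show ?case by (cases Xs) simp_all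
  qed
  show ?thesis using assms by (auto simp: multilinear_def[of _ _ "CB f"] intro: 1 2 3)
qed

lemma alternating_simps:
  assumes "alternating f"
  shows "f ((x, x) # Xs) z = 0" "f [(x, z)] z = 0" "f [(z, x)] z = 0"
    "f (Ys @ (x, x) # Xs) z = 0" "f (Ys @ [(x, z)]) z = 0" "f (Ys @ [(z, x)]) z = 0"
  using assms unfolding alternating_def by (metis append_Nil)+

lemma alternating_skew:
  assumes "alternating f" "ml f"
  shows "f ((y, x) # Xs) z = - f ((x, y) # Xs) z" "f [(x, z)] y = - f [(x, y)] z"
    "f [(z, x)] y = - f [(y, x)] z"
proof -
  note a = alternating_simps[OF assms(1)] and m = ml_add[OF assms(2)]
  have "f ((x, x) # Xs) z + f ((y, x) # Xs) z + (f ((x, y) # Xs) z + f ((y, y) # Xs) z)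
      = f ((x + y, x + y) # Xs) z"
    by (simp only: m)
  then show "f ((y, x) # Xs) z = - f ((x, y) # Xs) z"
    by (simp add: a eq_neg_iff_add_eq_0)
  have "f [(x, y)] y + f [(x, z)] y + (f [(x, y)] z + f [(x, z)] z) = f [(x, y + z)] (y + z)"
    by (simp only: m)
  then show "f [(x, z)] y = - f [(x, y)] z"
    by (simp add: a eq_neg_iff_add_eq_0)
  have "f [(y, x)] y + f [(z, x)] y + (f [(y, x)] z + f [(z, x)] z) = f [(y + z, x)] (y + z)"
    by (simp only: m)
  then show "f [(z, x)] y = - f [(y, x)] z"
    by (simp add: a eq_neg_iff_add_eq_0)
qed

lemma LD_zero: "LD X (\<lambda>Ws w. 0) Ys z = 0"
  using LD_diff[of X "\<lambda>Ws w. 0" "\<lambda>Ws w. 0"] by simp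

lemma CB_zero: "CB (\<lambda>Ws w. 0) Ys z = 0"
  using CB_diff[of "\<lambda>Ws w. 0" "\<lambda>Ws w. 0"] by simp

text \<open>
  The vanishing on a repeated argument is used together with the skew-symmetry it implies: a bracket
  with \<open>X\<close> that hits one copy of the repeated argument is cancelled by the one that hits the other copy.
\<close>

lemma alternating_LD:
  assumes "alternating f" "ml f" shows "alternating (LD X f)"
proof -
  obtain a b where X: "X = (a, b)" by force
  have 1: "LD X f (Xs @ (x, x) # Ys) z = 0" if "alternating f" "ml f" for f Xs x Ys z
    using that
  proof (induction Xs arbitrary: f)
    case Nil
    have "contract (x, x) f = (\<lambda>Ws w. 0)"
      using Nil by (simp add: contract_def[abs_def] alternating_simps fun_eq_iff)
    then show ?case
      using alternating_skew(1)[OF Nil, of "br a b x" x] by (simp add: LD_zero X)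
  next
    case (Cons Y Xs)
    have "f (W # Xs @ (x, x) # Ys) z = 0" for W
      using alternating_simps(4)[OF Cons.prems(1), of "W # Xs"] by simp
    then show ?case
      using Cons.IH[OF alternating_contract multilinear_contract] Cons.prems by simp
  qed
  have 2: "LD X f (Xs @ [(x, z)]) z = 0" if "alternating f" "ml f" for f Xs x z
    using that
  proof (induction Xs arbitrary: f)
    case Nil
    then show ?case
      using alternating_skew(2)[OF Nil, of x "br a b z" z] by (simp add: X contract_def alternating_simps rho_0)
  next
    case (Cons Y Xs)
    have "f (W # Xs @ [(x, z)]) z = 0" for W
      using alternating_simps(5)[OF Cons.prems(1), of "W # Xs"] by simp
    then show ?case
      using Cons.IH[OF alternating_contract multilinear_contract] Cons.prems by simp
  qed
  have 3: "LD X f (Xs @ [(z, x)]) z = 0" if "alternating f" "ml f" for f Xs x z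
    using that
  proof (induction Xs arbitrary: f)
    case Nil
    then show ?case
      using alternating_skew(3)[OF Nil, of "br a b z" x z] by (simp add: X contract_def alternating_simps rho_0)
  next
    case (Cons Y Xs)
    have "f (W # Xs @ [(z, x)]) z = 0" for W
      using alternating_simps(6)[OF Cons.prems(1), of "W # Xs"] by simp
    then show ?case
      using Cons.IH[OF alternating_contract multilinear_contract] Cons.prems by simp
  qed
  show ?thesis using assms by (auto simp: alternating_def[of "LD X f"] intro: 1 2 3)
qed

lemma LD_diagonal:
  assumes "ml f" shows "LD (x, x) f Ys z = 0"
  using assms
proof (induction Ys arbitrary: f)
  case Nil
  then show ?case by (simp add: rho_alt br_alt12 ml_0)
next
  case (Cons Y Ys)
  then show ?case
    using Cons.IH[OF multilinear_contract[OF Cons.prems]] by (simp add: br_alt12 ml_0)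
qed

text \<open>
  The operators \<open>L\<^sub>X\<close> and \<open>\<iota>\<^sub>X\<close> vanish for \<open>X = x \<and> x\<close>, and a repetition behind the first pair is
  inherited by both parts of the Cartan formula. This ends with a single pair, where the coboundary of
  any linear map is alternating in all three arguments.
\<close>

lemma alternating_CB:
  assumes "alternating f" "ml f" shows "alternating (CB f)"
proof -
  have 1: "CB f (Xs @ (x, x) # Ys) z = 0" if "alternating f" "ml f" for f Xs x Ys z
    using that
  proof (induction Xs arbitrary: f)
    case Nil
    have "contract (x, x) f = (\<lambda>Ws w. 0)"
      using Nil by (simp add: contract_def[abs_def] alternating_simps fun_eq_iff)
    then show ?case
      using LD_diagonal[OF Nil(2)] rho_skew[of x z]
      by (cases Ys) (simp_all add: CB_zero rho_alt br_alt12 ml_0[OF Nil(2)] del: lie_deriv.simps)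
  next
    case (Cons Y Xs)
    then have "LD Y f (Xs @ (x, x) # Ys) z - CB (contract Y f) (Xs @ (x, x) # Ys) z = 0"
      by (simp add: alternating_simps alternating_LD alternating_contract multilinear_contract)
    then show ?case by (cases Xs) simp_all
  qed
  have 2: "CB f (Xs @ [(x, z)]) z = 0" if "alternating f" "ml f" for f Xs x z
    using that
  proof (induction Xs arbitrary: f)
    case Nil
    then show ?case
      using rho_skew[of x z] by (simp add: rho_alt br_alt23 ml_0[OF Nil(2)])
  next
    case (Cons Y Xs)
    then have "LD Y f (Xs @ [(x, z)]) z - CB (contract Y f) (Xs @ [(x, z)]) z = 0"
      by (simp add: alternating_simps alternating_LD alternating_contract multilinear_contract)
    then show ?case by (cases Xs) simp_all
  qed
  have 3: "CB f (Xs @ [(z, x)]) z = 0" if "alternating f" "ml f" for f Xs x z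
    using that
  proof (induction Xs arbitrary: f)
    case Nil
    then show ?case
      using rho_skew[of x z] by (simp add: rho_alt br_alt13 ml_0[OF Nil(2)])
  next
    case (Cons Y Xs)
    then have "LD Y f (Xs @ [(z, x)]) z - CB (contract Y f) (Xs @ [(z, x)]) z = 0"
      by (simp add: alternating_simps alternating_LD alternating_contract multilinear_contract)
    then show ?case by (cases Xs) simp_all
  qed
  show ?thesis using assms by (auto simp: alternating_def[of "CB f"] intro: 1 2 3)
qed

end

section \<open>The 3-Lie algebra and the representation induced by a Rota-Baxter operator\<close>

context rota_baxter_representation
begin

abbreviation brR where "brR \<equiv> br_RB scaleA br lam R"
abbreviation S where "S \<equiv> rho_S scaleV rho lam R"
abbreviation rhoR where "rhoR \<equiv> rho_RB scaleV rho lam R RV"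

lemma R_add: "R (x + y) = R x + R y" and R_scale: "R (scaleA c x) = scaleA c (R x)"
  using R_linear by (simp_all add: Vector_Spaces.linear_iff)

lemma RV_add: "RV (x + y) = RV x + RV y" and RV_scale: "RV (scaleV c x) = scaleV c (RV x)"
  using RV_linear by (simp_all add: Vector_Spaces.linear_iff)

lemma RV_diff: "RV (x - y) = RV x - RV y"
  using RV_add[of "x - y" y] by (simp add: algebra_simps)

lemma S_add: "S x y (u + v) = S x y u + S x y v" "S (x + x') y u = S x y u + S x' y u"
    "S x (y + y') u = S x y u + S x y' u"
  and S_scale: "S x y (scaleV c u) = scaleV c (S x y u)" "S (scaleA c x) y u = scaleV c (S x y u)"
    "S x (scaleA c y) u = scaleV c (S x y u)"
  by (simp_all add: rho_S_def rho_add rho_scale R_add R_scale V.scale_right_distrib V.scale_left_commute algebra_simps)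

lemma S_diff: "S x y (u - v) = S x y u - S x y v"
  using S_add(1)[of x y "u - v" v] by (simp add: algebra_simps)

lemma brR_add: "brR (x + x') y z = brR x y z + brR x' y z" "brR x (y + y') z = brR x y z + brR x y' z"
    "brR x y (z + z') = brR x y z + brR x y z'"
  by (simp_all add: br_RB_def br_add R_add scale_right_distrib)

lemma brR_scale: "brR (scaleA c x) y z = scaleA c (brR x y z)" "brR x (scaleA c y) z = scaleA c (brR x y z)"
    "brR x y (scaleA c z) = scaleA c (brR x y z)"
  by (simp_all add: br_RB_def br_scale R_scale scale_right_distrib mult.commute)

text \<open>
  The fundamental identity is read off from the identity for \<open>A[t]\<close> with \<open>t\<^sup>2 = \<lambda>t\<close> by comparing
  coefficients of \<open>t\<close>: the adjoint map of \<open>(R + t)x\<^sub>1 \<and> (R + t)x\<^sub>2\<close> is \<open>D\<^sub>0 + tD\<^sub>1\<close> with \<open>D\<^sub>0\<close> and \<open>D\<^sub>1\<close>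
  derivations of \<open>A\<close>. Setting \<open>t = \<lambda>\<close> shows that \<open>R' = R + \<lambda>\<close>, like \<open>R\<close>, is a homomorphism from \<open>A\<^sub>R\<close>
  to \<open>A\<close>. This avoids the 31 instances of the fundamental identity in a full expansion.
\<close>

theorem three_lie_algebra_RB: "three_lie_algebra scaleA brR"
proof (intro three_lie_algebra.intro three_lie_algebra_axioms.intro)
  show "vector_space scaleA" by (rule vector_space_axioms)
  show "Vector_Spaces.linear scaleA scaleA (\<lambda>x. brR x y z)"
    "Vector_Spaces.linear scaleA scaleA (\<lambda>x. brR y x z)"
    "Vector_Spaces.linear scaleA scaleA (\<lambda>x. brR y z x)" for y z
    by (simp_all add: Vector_Spaces.linear_iff vector_space_axioms brR_add brR_scale)
  show "brR x x z = 0" for x z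
    using br_skew(1)[of "R x" x "R z"] br_skew(1)[of "R x" x z]
    by (simp add: br_RB_def br_alt12)
  show "brR x y x = 0" for x y
    using br_skew(3)[of "R x" _ x] by (simp add: br_RB_def br_alt13)
  show "brR x y y = 0" for x y
    using br_skew(2)[of "R x" "R y" y] br_skew(2)[of x "R y" y]
    by (simp add: br_RB_def br_alt23)
  fix x\<^sub>1 x\<^sub>2 y\<^sub>1 y\<^sub>2 y\<^sub>3
  define D0 where "D0 w = br (R x\<^sub>1) (R x\<^sub>2) w" for w
  define D1 where "D1 w = br (R x\<^sub>1) x\<^sub>2 w + br x\<^sub>1 (R x\<^sub>2) w + scaleA lam (br x\<^sub>1 x\<^sub>2 w)" for w
  define R' where "R' w = R w + scaleA lam w" for w
  have D0_deriv: "D0 (br u v w) = br (D0 u) v w + br u (D0 v) w + br u v (D0 w)" for u v w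
    unfolding D0_def by (rule fundamental_identity)
  have D1_deriv: "D1 (br u v w) = br (D1 u) v w + br u (D1 v) w + br u v (D1 w)" for u v w
    unfolding D1_def fundamental_identity[of _ _ u v w]
    by (simp add: br_add br_scale scale_right_distrib)
  have D0_add: "D0 (u + v) = D0 u + D0 v" and D0_scale: "D0 (scaleA c u) = scaleA c (D0 u)" for u v c
    by (simp_all add: D0_def br_add br_scale)
  \<comment> \<open>The coefficient of \<open>t\<close> in \<open>(D\<^sub>0 + tD\<^sub>1)(R + t)w\<close>.\<close>
  have ad: "brR x\<^sub>1 x\<^sub>2 w = D0 w + D1 (R' w)" for w
    by (simp add: br_RB_def D0_def D1_def R'_def br_add br_scale scale_right_distrib power2_eq_square ac_simps)
  have R_ad: "R (brR x\<^sub>1 x\<^sub>2 w) = D0 (R w)" for w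
    by (simp add: D0_def rota_baxter)
  have R'_brR: "R' (brR u v w) = br (R' u) (R' v) (R' w)" for u v w
    by (simp add: R'_def rota_baxter[symmetric] br_add br_scale)
      (simp add: br_RB_def scale_right_distrib power2_eq_square ac_simps)
  have L: "brR x\<^sub>1 x\<^sub>2 (brR y\<^sub>1 y\<^sub>2 y\<^sub>3) = D0 (brR y\<^sub>1 y\<^sub>2 y\<^sub>3)
      + (br (D1 (R' y\<^sub>1)) (R' y\<^sub>2) (R' y\<^sub>3) + br (R' y\<^sub>1) (D1 (R' y\<^sub>2)) (R' y\<^sub>3)
         + br (R' y\<^sub>1) (R' y\<^sub>2) (D1 (R' y\<^sub>3)))"
    by (simp only: ad R'_brR D1_deriv)
  show "brR x\<^sub>1 x\<^sub>2 (brR y\<^sub>1 y\<^sub>2 y\<^sub>3) =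
         brR (brR x\<^sub>1 x\<^sub>2 y\<^sub>1) y\<^sub>2 y\<^sub>3 + brR y\<^sub>1 (brR x\<^sub>1 x\<^sub>2 y\<^sub>2) y\<^sub>3 + brR y\<^sub>1 y\<^sub>2 (brR x\<^sub>1 x\<^sub>2 y\<^sub>3)"
    by (simp only: L br_RB_def[of scaleA br lam R "brR x\<^sub>1 x\<^sub>2 y\<^sub>1"]
        br_RB_def[of scaleA br lam R _ "brR x\<^sub>1 x\<^sub>2 y\<^sub>2"] br_RB_def[of scaleA br lam R _ _ "brR x\<^sub>1 x\<^sub>2 y\<^sub>3"] R_ad)
      (simp add: ad br_RB_def[of _ _ _ _ y\<^sub>1 y\<^sub>2 y\<^sub>3] D0_add D0_scale D0_deriv D1_deriv R'_def[of y\<^sub>1] R'_def[of y\<^sub>2] R'_def[of y\<^sub>3]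
        br_add br_scale scale_right_distrib power2_eq_square ac_simps)
qed

text \<open>
  The modified action is the image under \<open>v + tw \<mapsto> v - R\<^sub>Vw\<close> of the action of \<open>(R + t)x \<and> (R + t)y\<close>,
  that is of \<open>\<rho>(Rx,Ry) + tS(x,y)\<close>, on \<open>V[t]\<close>; the argument of \<open>R\<^sub>V\<close> on the right is the coefficient of
  \<open>t\<close> in the product of two such operators.
\<close>

lemma rhoR_rhoR:
  "rhoR x\<^sub>1 x\<^sub>2 (rhoR x\<^sub>3 x\<^sub>4 v) = rho (R x\<^sub>1) (R x\<^sub>2) (rho (R x\<^sub>3) (R x\<^sub>4) v)
     - RV (S x\<^sub>1 x\<^sub>2 (rho (R x\<^sub>3) (R x\<^sub>4) v) + rho (R x\<^sub>1) (R x\<^sub>2) (S x\<^sub>3 x\<^sub>4 v)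
           + scaleV lam (S x\<^sub>1 x\<^sub>2 (S x\<^sub>3 x\<^sub>4 v)))"
  unfolding rho_RB_def rho_diff RV_compat S_diff by (simp add: RV_add RV_diff RV_scale algebra_simps)

text \<open>
  By the preceding product formula, each axiom splits into its constant term, which is the same axiom
  for \<open>A\<close> at the elements \<open>Rx\<^sub>i\<close>, and its coefficient of \<open>t\<close>, which is the sum of the axiom for \<open>A\<close>
  over all ways to apply \<open>R\<close> to at most three of the four elements, weighted with powers of \<open>\<lambda>\<close>.
\<close>

theorem three_lie_representation_RB: "three_lie_representation scaleA brR scaleV rhoR"
proof -
  interpret AR: three_lie_algebra scaleA brR by (rule three_lie_algebra_RB)
  show ?thesis
  proof (intro three_lie_representation.intro three_lie_representation_axioms.intro)
    show "three_lie_algebra scaleA brR" "vector_space scaleV"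
      by (rule three_lie_algebra_RB V.vector_space_axioms)+
    show "Vector_Spaces.linear scaleV scaleV (rhoR x y)"
      "Vector_Spaces.linear scaleA scaleV (\<lambda>x. rhoR x y v)"
      "Vector_Spaces.linear scaleA scaleV (\<lambda>y. rhoR x y v)" for x y v
      by (simp_all add: Vector_Spaces.linear_iff vector_space_axioms V.vector_space_axioms rho_RB_def
          R_add R_scale rho_add rho_scale S_add S_scale RV_add RV_scale V.scale_right_diff_distrib)
    have RV_0: "RV 0 = 0" using RV_add[of 0 0] by simp
    show "rhoR x x v = 0" for x v
      using rho_skew[of x "R x" v] by (simp add: rho_RB_def rho_S_def rho_alt RV_0)
    fix x\<^sub>1 x\<^sub>2 x\<^sub>3 x\<^sub>4 v
    have c: "rho a b (rho c e v) = rho c e (rho a b v) + rho (br a b c) e v - rho (br a b e) c v" for a b c e v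
      using rho_commutator[of a b c e v] by (simp add: algebra_simps)
    \<comment> \<open>The commutator axiom is instantiated at each of the 15 ways to apply \<open>R\<close> to at most three elements, since as a general
      rewrite rule it would not terminate.\<close>
    have "S x\<^sub>1 x\<^sub>2 (rho (R x\<^sub>3) (R x\<^sub>4) v) + rho (R x\<^sub>1) (R x\<^sub>2) (S x\<^sub>3 x\<^sub>4 v) + scaleV lam (S x\<^sub>1 x\<^sub>2 (S x\<^sub>3 x\<^sub>4 v))
      = (S x\<^sub>3 x\<^sub>4 (rho (R x\<^sub>1) (R x\<^sub>2) v) + rho (R x\<^sub>3) (R x\<^sub>4) (S x\<^sub>1 x\<^sub>2 v) + scaleV lam (S x\<^sub>3 x\<^sub>4 (S x\<^sub>1 x\<^sub>2 v)))
        + (S (brR x\<^sub>1 x\<^sub>2 x\<^sub>3) x\<^sub>4 v - S (brR x\<^sub>1 x\<^sub>2 x\<^sub>4) x\<^sub>3 v)"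
      unfolding rho_S_def rota_baxter[symmetric]
      by (simp only: rho_add rho_scale V.scale_right_distrib V.scale_right_diff_distrib br_RB_def
      c[of x\<^sub>1 x\<^sub>2 x\<^sub>3 x\<^sub>4 v]
      c[of x\<^sub>1 x\<^sub>2 x\<^sub>3 "R x\<^sub>4" v]
      c[of x\<^sub>1 x\<^sub>2 "R x\<^sub>3" x\<^sub>4 v]
      c[of x\<^sub>1 x\<^sub>2 "R x\<^sub>3" "R x\<^sub>4" v]
      c[of x\<^sub>1 "R x\<^sub>2" x\<^sub>3 x\<^sub>4 v]
      c[of x\<^sub>1 "R x\<^sub>2" x\<^sub>3 "R x\<^sub>4" v]
      c[of x\<^sub>1 "R x\<^sub>2" "R x\<^sub>3" x\<^sub>4 v]
      c[of x\<^sub>1 "R x\<^sub>2" "R x\<^sub>3" "R x\<^sub>4" v]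
      c[of "R x\<^sub>1" x\<^sub>2 x\<^sub>3 x\<^sub>4 v]
      c[of "R x\<^sub>1" x\<^sub>2 x\<^sub>3 "R x\<^sub>4" v]
      c[of "R x\<^sub>1" x\<^sub>2 "R x\<^sub>3" x\<^sub>4 v]
      c[of "R x\<^sub>1" x\<^sub>2 "R x\<^sub>3" "R x\<^sub>4" v]
      c[of "R x\<^sub>1" "R x\<^sub>2" x\<^sub>3 x\<^sub>4 v]
      c[of "R x\<^sub>1" "R x\<^sub>2" x\<^sub>3 "R x\<^sub>4" v]
      c[of "R x\<^sub>1" "R x\<^sub>2" "R x\<^sub>3" x\<^sub>4 v])
        (simp add: V.scale_right_distrib V.scale_right_diff_distrib power2_eq_square algebra_simps)
    from arg_cong[OF this, of RV]
    show "rhoR x\<^sub>1 x\<^sub>2 (rhoR x\<^sub>3 x\<^sub>4 v) - rhoR x\<^sub>3 x\<^sub>4 (rhoR x\<^sub>1 x\<^sub>2 v) =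
         rhoR (brR x\<^sub>1 x\<^sub>2 x\<^sub>3) x\<^sub>4 v - rhoR (brR x\<^sub>1 x\<^sub>2 x\<^sub>4) x\<^sub>3 v"
      unfolding rhoR_rhoR rho_RB_def[of _ _ _ _ _ "brR _ _ _"] rota_baxter[symmetric]
      by (simp add: c[of "R x\<^sub>1" "R x\<^sub>2" "R x\<^sub>3" "R x\<^sub>4" v] RV_add RV_diff algebra_simps)
    have "S (brR x\<^sub>1 x\<^sub>2 x\<^sub>3) x\<^sub>4 v =
        (S x\<^sub>1 x\<^sub>2 (rho (R x\<^sub>3) (R x\<^sub>4) v) + rho (R x\<^sub>1) (R x\<^sub>2) (S x\<^sub>3 x\<^sub>4 v) + scaleV lam (S x\<^sub>1 x\<^sub>2 (S x\<^sub>3 x\<^sub>4 v)))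
      + (S x\<^sub>2 x\<^sub>3 (rho (R x\<^sub>1) (R x\<^sub>4) v) + rho (R x\<^sub>2) (R x\<^sub>3) (S x\<^sub>1 x\<^sub>4 v) + scaleV lam (S x\<^sub>2 x\<^sub>3 (S x\<^sub>1 x\<^sub>4 v)))
      + (S x\<^sub>3 x\<^sub>1 (rho (R x\<^sub>2) (R x\<^sub>4) v) + rho (R x\<^sub>3) (R x\<^sub>1) (S x\<^sub>2 x\<^sub>4 v) + scaleV lam (S x\<^sub>3 x\<^sub>1 (S x\<^sub>2 x\<^sub>4 v)))"
      unfolding rho_S_def rota_baxter[symmetric]
      by (simp only: rho_add rho_scale V.scale_right_distrib br_RB_def rho_bracket)
        (simp add: V.scale_right_distrib power2_eq_square ac_simps)
    from arg_cong[OF this, of RV]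
    show "rhoR (brR x\<^sub>1 x\<^sub>2 x\<^sub>3) x\<^sub>4 v =
         rhoR x\<^sub>1 x\<^sub>2 (rhoR x\<^sub>3 x\<^sub>4 v) + rhoR x\<^sub>2 x\<^sub>3 (rhoR x\<^sub>1 x\<^sub>4 v) + rhoR x\<^sub>3 x\<^sub>1 (rhoR x\<^sub>2 x\<^sub>4 v)"
      unfolding rhoR_rhoR rho_RB_def[of _ _ _ _ _ "brR _ _ _"] rota_baxter[symmetric] rho_bracket
      by (simp add: RV_add RV_diff algebra_simps)
  qed
qed

end

section \<open>Evaluating cochains at the shifted operator \<open>R + t\<close>\<close>

text \<open>
  A pair \<open>(v, w)\<close> stands for \<open>v + tw\<close> in \<open>V[t]\<close> with \<open>t\<^sup>2 = \<lambda>t\<close>; the product with \<open>t\<close> is \<open>t(v + \<lambda>w)\<close>.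
\<close>

definition t_mult :: "('k::field \<Rightarrow> 'v \<Rightarrow> 'v) \<Rightarrow> 'k \<Rightarrow> 'v \<times> 'v \<Rightarrow> 'v \<times> 'v::ab_group_add" where
  "t_mult scaleV lam p = (0, fst p + scaleV lam (snd p))"

text \<open>
  The coefficient of \<open>t\<close> in the insertion of \<open>(R + t)x \<and> (R + t)y\<close>; the constant term is the insertion of
  \<open>Rx \<and> Ry\<close>.
\<close>

definition contract_t ::
  "('k::field \<Rightarrow> 'v \<Rightarrow> 'v) \<Rightarrow> 'k \<Rightarrow> ('a \<Rightarrow> 'a) \<Rightarrow> 'a \<times> 'a
     \<Rightarrow> ('a, 'v::ab_group_add) cochain \<Rightarrow> ('a, 'v) cochain" where
  "contract_t scaleV lam R X f Xs z =
     f ((R (fst X), snd X) # Xs) z + f ((fst X, R (snd X)) # Xs) z + scaleV lam (f (X # Xs) z)"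

text \<open>
  The value of the \<open>t\<close>-linear extension of \<open>f\<close> at the arguments \<open>(R + t)x\<^sub>1, (R + t)y\<^sub>1, \<dots>, (R + t)z\<close>.
  Recursion over the pairs produces it without extending \<open>f\<close> to \<open>A[t]\<close>.
\<close>

fun eval_shift ::
  "('k::field \<Rightarrow> 'v \<Rightarrow> 'v) \<Rightarrow> 'k \<Rightarrow> ('a \<Rightarrow> 'a)
     \<Rightarrow> ('a, 'v::ab_group_add) cochain \<Rightarrow> ('a, 'v \<times> 'v) cochain" where
  "eval_shift scaleV lam R f [] z = (f [] (R z), f [] z)"
| "eval_shift scaleV lam R f (X # Xs) z =
     eval_shift scaleV lam R (contract (map_prod R R X) f) Xs z
     + t_mult scaleV lam (eval_shift scaleV lam R (contract_t scaleV lam R X f) Xs z)"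

lemma eval_shift_cong:
  assumes "\<And>Ws w. length Ws = length Ys \<Longrightarrow> f Ws w = g Ws w"
  shows "eval_shift scaleV lam R f Ys z = eval_shift scaleV lam R g Ys z"
  using assms
proof (induction Ys arbitrary: f g)
  case (Cons Y Ys)
  have "eval_shift scaleV lam R (contract (map_prod R R Y) f) Ys z
      = eval_shift scaleV lam R (contract (map_prod R R Y) g) Ys z"
    "eval_shift scaleV lam R (contract_t scaleV lam R Y f) Ys z
      = eval_shift scaleV lam R (contract_t scaleV lam R Y g) Ys z"
    by (intro Cons.IH; simp add: contract_def contract_t_def Cons.prems)+
  then show ?case by simp
qed simp

context rota_baxter_representation
begin

abbreviation \<tau> where "\<tau> \<equiv> t_mult scaleV lam"
abbreviation E where "E \<equiv> eval_shift scaleV lam R"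
abbreviation ctr_t where "ctr_t \<equiv> contract_t scaleV lam R"
abbreviation RR where "RR \<equiv> map_prod R R"

text \<open>
  The action of \<open>(R + t)x \<and> (R + t)y\<close> on \<open>V[t]\<close>, expanded with \<open>t\<^sup>2 = \<lambda>t\<close>.
\<close>

definition rho_t :: "'a \<Rightarrow> 'a \<Rightarrow> 'v \<times> 'v \<Rightarrow> 'v \<times> 'v" where
  "rho_t x y p = (rho (R x) (R y) (fst p),
     S x y (fst p) + rho (R x) (R y) (snd p) + scaleV lam (S x y (snd p)))"

text \<open>
  The evaluation of \<open>v + tw\<close> at \<open>t = - R\<^sub>V\<close>.
\<close>

definition eval_RV :: "'v \<times> 'v \<Rightarrow> 'v" where
  "eval_RV p = fst p - RV (snd p)"

abbreviation LT where "LT \<equiv> lie_deriv brR rho_t"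
abbreviation CT where "CT \<equiv> cartan_coboundary brR rho_t"

text \<open>
  The coefficient of \<open>t\<close> in the Lie derivative along \<open>(R + t)x \<and> (R + t)y\<close>.
\<close>

definition LD_t :: "'a \<times> 'a \<Rightarrow> ('a, 'v) cochain \<Rightarrow> ('a, 'v) cochain" where
  "LD_t X f Ys z = LD (R (fst X), snd X) f Ys z + LD (fst X, R (snd X)) f Ys z + scaleV lam (LD X f Ys z)"

lemma tau_add: "\<tau> (p + q) = \<tau> p + \<tau> q"
  by (simp add: t_mult_def prod_eq_iff V.scale_right_distrib)

lemma tau_diff: "\<tau> (p - q) = \<tau> p - \<tau> q"
  by (simp add: t_mult_def prod_eq_iff V.scale_right_diff_distrib)

lemma tau_0: "\<tau> 0 = 0"
  by (simp add: t_mult_def prod_eq_iff)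

lemma eval_RV_add: "eval_RV (p + q) = eval_RV p + eval_RV q"
  by (simp add: eval_RV_def RV_add)

lemma rho_t_add: "rho_t x y (p + q) = rho_t x y p + rho_t x y q"
  by (simp add: rho_t_def prod_eq_iff rho_add S_add V.scale_right_distrib)

lemma rho_t_tau: "rho_t x y (\<tau> p) = \<tau> (rho_t x y p)"
  by (simp add: rho_t_def t_mult_def prod_eq_iff rho_0 rho_S_def rho_add rho_scale
      V.scale_right_distrib power2_eq_square ac_simps)

text \<open>
  In this form the condition on \<open>R\<^sub>V\<close> in a representation of \<open>(A, R)\<close> becomes natural.
\<close>

lemma rhoR_eval_RV: "rhoR x y (eval_RV p) = eval_RV (rho_t x y p)"
  unfolding eval_RV_def rho_t_def rho_RB_def rho_diff RV_compat S_diff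
  by (simp add: RV_add RV_diff RV_scale algebra_simps)

lemma eval_shift_add: "E (\<lambda>Ws w. f Ws w + g Ws w) Ys z = E f Ys z + E g Ys z"
proof (induction Ys arbitrary: f g)
  case (Cons Y Ys)
  have "contract (RR Y) (\<lambda>Ws w. f Ws w + g Ws w) = (\<lambda>Ws w. contract (RR Y) f Ws w + contract (RR Y) g Ws w)"
    "ctr_t Y (\<lambda>Ws w. f Ws w + g Ws w) = (\<lambda>Ws w. ctr_t Y f Ws w + ctr_t Y g Ws w)"
    by (simp_all add: contract_def contract_t_def V.scale_right_distrib fun_eq_iff)
  then show ?case by (simp add: Cons.IH tau_add)
qed simp

lemma eval_shift_diff: "E (\<lambda>Ws w. f Ws w - g Ws w) Ys z = E f Ys z - E g Ys z"
  using eval_shift_add[of "\<lambda>Ws w. f Ws w - g Ws w" g Ys z] by (simp add: algebra_simps)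

lemma eval_shift_zero: "E (\<lambda>Ws w. 0) Ys z = 0"
  using eval_shift_diff[of "\<lambda>Ws w. 0" "\<lambda>Ws w. 0"] by simp

lemma eval_shift_scale:
  "E (\<lambda>Ws w. scaleV c (f Ws w)) Ys z = map_prod (scaleV c) (scaleV c) (E f Ys z)"
proof (induction Ys arbitrary: f)
  case (Cons Y Ys)
  have "contract (RR Y) (\<lambda>Ws w. scaleV c (f Ws w)) = (\<lambda>Ws w. scaleV c (contract (RR Y) f Ws w))"
    "ctr_t Y (\<lambda>Ws w. scaleV c (f Ws w)) = (\<lambda>Ws w. scaleV c (ctr_t Y f Ws w))"
    by (simp_all add: contract_def contract_t_def V.scale_right_distrib fun_eq_iff mult.commute)
  then show ?case 
    by (simp add: Cons.IH t_mult_def prod_eq_iff V.scale_right_distrib mult.commute)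
qed simp

lemma tau_tau_eval_shift: "\<tau> (\<tau> (E f Ys z)) = \<tau> (E (\<lambda>Ws w. scaleV lam (f Ws w)) Ys z)"
  by (simp add: eval_shift_scale t_mult_def prod_eq_iff V.scale_right_distrib)

lemma contract_eval_shift: "contract Y (E f) = (\<lambda>Ws w. E (contract (RR Y) f) Ws w + \<tau> (E (ctr_t Y f) Ws w))"
  by (simp add: contract_def[of Y] fun_eq_iff)

lemma LD_scale: "LD X (\<lambda>Ws w. scaleV c (f Ws w)) Ys z = scaleV c (LD X f Ys z)"
  by (rule lie_deriv_intertwine) (simp_all add: V.scale_right_distrib rho_scale)

lemma CB_scale: "CB (\<lambda>Ws w. scaleV c (f Ws w)) Ys z = scaleV c (CB f Ys z)"
  by (rule cartan_coboundary_intertwine) (simp_all add: V.scale_right_distrib rho_scale)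

lemma ctr_t_expand:
  "ctr_t (x, y) f = (\<lambda>Ws w. contract (R x, y) f Ws w + contract (x, R y) f Ws w + scaleV lam (contract (x, y) f Ws w))"
  by (simp add: contract_t_def contract_def fun_eq_iff)

lemma ml_contract_t:
  assumes "ml f" shows "ml (ctr_t X f)"
proof -
  have "lin (\<lambda>t. f (W # Ws) t)" "lin (\<lambda>x. f (W # Ys @ (x, y) # Ws) z)" "lin (\<lambda>x. f (W # Ys @ (y, x) # Ws) z)" for W Ws Ys y z
    using assms ml_lin(4,5)[OF assms, of "W # Ys"] by (auto intro: ml_lin)
  then show ?thesis
    unfolding multilinear_def contract_t_def[abs_def] append_Cons[symmetric]
    by (cases X) (auto intro!: lin_intros)
qed

text \<open>
  Lie derivatives are natural under \<open>R + t\<close>: along \<open>X\<close> on the side of \<open>A\<^sub>R\<close> and along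
  \<open>(R + t)X = RX + t(\<dots>)\<close> on the side of \<open>A\<close>. In the induction step the commutator
  \<open>[L\<^bsub>(R+t)X\<^esub>, \<iota>\<^bsub>(R+t)Y\<^esub>] = \<iota>\<^bsub>(R+t)[X,Y]\<^esub>\<close> is needed, with the bracket of \<open>A\<^sub>R\<close> on the right, and it is
  checked separately for the constant term and for the coefficient of \<open>t\<close>.
\<close>

lemma LT_eval_shift:
  assumes "ml f"
  shows "LT X (E f) Ys z = E (LD (RR X) f) Ys z + \<tau> (E (LD_t X f) Ys z)"
  using assms
proof (induction Ys arbitrary: f)
  case Nil
  obtain a b where X: "X = (a, b)" by force
  have *: "f [] (brR a b z) = f [] (br (R a) (R b) z)
     + (f [] (br (R a) b (R z)) + f [] (br a (R b) (R z)) + scaleV lam (f [] (br a b (R z))))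
     + scaleV lam (f [] (br (R a) b z) + f [] (br a (R b) z) + scaleV lam (f [] (br a b z)))"
    by (simp add: br_RB_def ml_add[OF Nil] ml_scale[OF Nil] V.scale_right_distrib power2_eq_square ac_simps)
  show ?case
    by (simp add: X t_mult_def LD_t_def rho_t_def prod_eq_iff * rota_baxter[symmetric] rho_S_def
        V.scale_right_distrib V.scale_right_diff_distrib algebra_simps)
next
  case (Cons Y Ys)
  obtain a b where X: "X = (a, b)" by force
  obtain c e where Y: "Y = (c, e)" by force
  note ml = Cons.prems
  let ?U = "(brR a b c, e)" and ?W = "(c, brR a b e)"
  have IH1: "LT X (E (contract (RR Y) f)) Ys z
      = E (LD (RR X) (contract (RR Y) f)) Ys z + \<tau> (E (LD_t X (contract (RR Y) f)) Ys z)"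
    by (intro Cons.IH multilinear_contract ml)
  have IH2: "LT X (E (ctr_t Y f)) Ys z = E (LD (RR X) (ctr_t Y f)) Ys z + \<tau> (E (LD_t X (ctr_t Y f)) Ys z)"
    by (intro Cons.IH ml_contract_t ml)
  \<comment> \<open>Constant term of the commutator: the Rota-Baxter identity in both slots of \<open>Y\<close>.\<close>
  have 0: "contract (RR Y) (LD (RR X) f) = (\<lambda>Ws w. LD (RR X) (contract (RR Y) f) Ws w
      - contract (RR ?U) f Ws w - contract (RR ?W) f Ws w)"
    unfolding contract_LD by (simp add: X Y rota_baxter)
  have L: "LD A f ((u, v) # Ws) w = LD A (contract (u, v) f) Ws w
     - f ((br (fst A) (snd A) u, v) # Ws) w - f ((u, br (fst A) (snd A) v) # Ws) w" for A u v Ws w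
    by simp
  \<comment> \<open>Coefficient of \<open>t\<close> in the commutator: expand the bracket of \<open>A\<^sub>R\<close> by multilinearity of \<open>f\<close>.\<close>
  have 1: "ctr_t Y (LD (RR X) f) Ws w + contract (RR Y) (LD_t X f) Ws w + scaleV lam (ctr_t Y (LD_t X f) Ws w)
    = LD (RR X) (ctr_t Y f) Ws w + LD_t X (contract (RR Y) f) Ws w
      + scaleV lam (LD_t X (ctr_t Y f) Ws w) - ctr_t ?U f Ws w - ctr_t ?W f Ws w" for Ws w
    unfolding X Y ctr_t_expand
    unfolding contract_def[of _ "LD _ f"] contract_def[of _ "LD_t _ f"]
    unfolding LD_t_def LD_add LD_scale map_prod_simp fst_conv snd_conv L rota_baxter[symmetric]
    unfolding contract_def[of _ f Ws w] br_RB_def[of _ _ _ _ a b]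
    by (simp add: ml_add[OF ml] ml_scale[OF ml] V.scale_right_distrib V.scale_right_diff_distrib
        power2_eq_square algebra_simps)
  have "LT X (E f) (Y # Ys) z = LT X (contract Y (E f)) Ys z - E f (?U # Ys) z - E f (?W # Ys) z"
    by (simp add: X Y)
  also have "LT X (contract Y (E f)) Ys z = LT X (E (contract (RR Y) f)) Ys z + \<tau> (LT X (E (ctr_t Y f)) Ys z)"
    unfolding contract_eval_shift
    by (simp add: lie_deriv_add[of rho_t, OF rho_t_add]
        lie_deriv_intertwine[of \<tau> rho_t rho_t, OF tau_add rho_t_tau])
  finally have lhs: "LT X (E f) (Y # Ys) z = E (contract (RR Y) (LD (RR X) f)) Ys z
      + \<tau> (E (\<lambda>Ws w. LD (RR X) (ctr_t Y f) Ws w + LD_t X (contract (RR Y) f) Ws w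
      + scaleV lam (LD_t X (ctr_t Y f) Ws w) - ctr_t ?U f Ws w - ctr_t ?W f Ws w) Ys z)"
    unfolding IH1 IH2 0 eval_shift_diff eval_shift_add tau_add tau_diff tau_tau_eval_shift
    by (simp add: algebra_simps)
  have rhs: "E (LD (RR X) f) (Y # Ys) z + \<tau> (E (LD_t X f) (Y # Ys) z) = E (contract (RR Y) (LD (RR X) f)) Ys z
      + \<tau> (E (\<lambda>Ws w. ctr_t Y (LD (RR X) f) Ws w + contract (RR Y) (LD_t X f) Ws w
          + scaleV lam (ctr_t Y (LD_t X f) Ws w)) Ys z)"
    unfolding eval_shift.simps eval_shift_diff eval_shift_add tau_add tau_tau_eval_shift
    by (simp add: algebra_simps)
  show ?case unfolding lhs rhs 1 ..
qed

text \<open>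
  The Cartan formula has the same shape for \<open>A\<^sub>R\<close> acting on \<open>V[t]\<close> and for \<open>A\<close>, and \<open>\<partial>\<close> commutes with
  multiplication by \<open>t\<close>, so naturality of the Lie derivative gives naturality of \<open>\<partial>\<close>.
\<close>

lemma CT_eval_shift:
  assumes "ml f"
  shows "CT (E f) Ys z = E (CB f) Ys z"
  using assms
proof (induction Ys arbitrary: f rule: induct_list012)
  case 1
  show ?case by (simp add: zero_prod_def)
next
  case (2 X)
  obtain a b where X: "X = (a, b)" by force
  have *: "f [] (brR a b z) = f [] (br (R a) (R b) z)
     + (f [] (br (R a) b (R z)) + f [] (br a (R b) (R z)) + scaleV lam (f [] (br a b (R z))))
     + scaleV lam (f [] (br (R a) b z) + f [] (br a (R b) z) + scaleV lam (f [] (br a b z)))"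
    by (simp add: br_RB_def ml_add[OF 2] ml_scale[OF 2] V.scale_right_distrib power2_eq_square ac_simps)
  show ?case
    by (simp add: X t_mult_def contract_def contract_t_def rho_t_def prod_eq_iff * rota_baxter[symmetric] rho_S_def
        V.scale_right_distrib V.scale_right_diff_distrib algebra_simps)
next
  case (3 X Y Ys)
  note ml = 3(3)
  let ?Ys = "Y # Ys"
  have "CT (contract X (E f)) ?Ys z = CT (E (contract (RR X) f)) ?Ys z + \<tau> (CT (E (ctr_t X f)) ?Ys z)"
    unfolding contract_eval_shift
    by (simp only: cartan_coboundary_add[of rho_t, OF rho_t_add]
        cartan_coboundary_intertwine[of \<tau> rho_t rho_t, OF tau_add rho_t_tau])
  also have "\<dots> = E (CB (contract (RR X) f)) ?Ys z + \<tau> (E (CB (ctr_t X f)) ?Ys z)"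
    using 3(2)[OF multilinear_contract[OF ml]] 3(2)[OF ml_contract_t[OF ml]] by simp
  finally have 1: "CT (contract X (E f)) ?Ys z = E (CB (contract (RR X) f)) ?Ys z + \<tau> (E (CB (ctr_t X f)) ?Ys z)" .
  have "E (CB f) (X # ?Ys) z = E (contract (RR X) (CB f)) ?Ys z + \<tau> (E (ctr_t X (CB f)) ?Ys z)"
    by (rule eval_shift.simps(2))
  also have "E (contract (RR X) (CB f)) ?Ys z = E (\<lambda>Ws w. LD (RR X) f Ws w - CB (contract (RR X) f) Ws w) ?Ys z"
    by (rule eval_shift_cong) (auto intro!: contract_CB)
  also have "E (ctr_t X (CB f)) ?Ys z = E (\<lambda>Ws w. LD_t X f Ws w - CB (ctr_t X f) Ws w) ?Ys z"
  proof (rule eval_shift_cong)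
    fix Ws :: "('a \<times> 'a) list" and w assume "length Ws = length (Y # Ys)"
    then have ne: "Ws \<noteq> []" by auto
    obtain a b where X: "X = (a, b)" by force
    show "ctr_t X (CB f) Ws w = LD_t X f Ws w - CB (ctr_t X f) Ws w"
      unfolding X ctr_t_expand CB_add CB_scale LD_t_def contract_CB[OF ne]
      by (simp add: V.scale_right_diff_distrib)
  qed
  finally have "E (CB f) (X # ?Ys) z = LT X (E f) ?Ys z - CT (contract X (E f)) ?Ys z"
    unfolding 1 LT_eval_shift[OF ml] eval_shift_diff tau_diff by (simp add: algebra_simps)
  then show ?case by (simp only: cartan_coboundary.simps(3))
qed

text \<open>
  The map \<open>\<delta>\<close> in all degrees at once.
\<close>

definition rb_delta :: "('a, 'v) cochain \<Rightarrow> ('a, 'v) cochain" where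
  "rb_delta f Xs z = eval_RV (E f Xs z)"

theorem cartan_coboundary_rb_delta:
  assumes "ml f"
  shows "cartan_coboundary brR rhoR (rb_delta f) Xs z = rb_delta (CB f) Xs z"
  unfolding rb_delta_def[abs_def]
  by (simp add: cartan_coboundary_intertwine[of eval_RV rhoR rho_t, OF eval_RV_add rhoR_eval_RV] CT_eval_shift[OF assms])

section \<open>The image of a cochain is a cochain\<close>

definition lin2 :: "('a \<Rightarrow> 'v \<times> 'v) \<Rightarrow> bool" where
  "lin2 F \<longleftrightarrow> lin (\<lambda>x. fst (F x)) \<and> lin (\<lambda>x. snd (F x))"

lemma lin2_add: "lin2 F \<Longrightarrow> lin2 G \<Longrightarrow> lin2 (\<lambda>x. F x + G x)"
  by (simp add: lin2_def lin_intros)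

lemma lin2_tau: "lin2 F \<Longrightarrow> lin2 (\<lambda>x. \<tau> (F x))"
  by (simp add: lin2_def t_mult_def lin_intros)

lemma lin_eval_RV: "lin2 F \<Longrightarrow> lin (\<lambda>x. eval_RV (F x))"
  by (simp add: lin2_def lin_iff eval_RV_def RV_add RV_scale V.scale_right_diff_distrib)

lemma lin_R: "lin F \<Longrightarrow> lin (\<lambda>x. F (R x))"
  by (simp add: lin_iff R_add R_scale)

lemma lin2_eval_shift_param:
  assumes "\<And>Zs z. lin (\<lambda>t. F t Zs z)"
  shows "lin2 (\<lambda>t. E (F t) Ys z)"
  using assms
proof (induction Ys arbitrary: F)
  case (Cons Y Ys)
  have "lin2 (\<lambda>t. E (contract (RR Y) (F t)) Ys z)"
    by (intro Cons.IH) (simp add: contract_def Cons.prems)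
  moreover have "lin2 (\<lambda>t. E (ctr_t Y (F t)) Ys z)"
    by (intro Cons.IH) (simp add: contract_t_def lin_intros Cons.prems)
  ultimately show ?case by (simp add: lin2_add lin2_tau)
qed (simp add: lin2_def)

lemma lin2_eval_shift:
  assumes "ml f"
  shows "lin2 (E f Xs)" "lin2 (\<lambda>x. E f (Xs @ (x, y) # Ys) z)" "lin2 (\<lambda>y. E f (Xs @ (x, y) # Ys) z)"
proof -
  show "lin2 (E f Xs)" using assms
  proof (induction Xs arbitrary: f)
    case Nil
    show ?case using lin_R[OF ml_lin(1)[OF Nil]] ml_lin(1)[OF Nil] by (simp add: lin2_def)
  next
    case (Cons X Xs)
    have "lin2 (\<lambda>z. E (contract (RR X) f) Xs z + \<tau> (E (ctr_t X f) Xs z))"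
      by (intro lin2_add lin2_tau Cons.IH multilinear_contract ml_contract_t Cons.prems)
    then show ?case by simp
  qed
  show "lin2 (\<lambda>x. E f (Xs @ (x, y) # Ys) z)" using assms
  proof (induction Xs arbitrary: f)
    case Nil
    have "lin (\<lambda>x. contract (R x, R y) f Zs w)" "lin (\<lambda>x. ctr_t (x, y) f Zs w)" for Zs w
      using ml_lin(2)[OF Nil] lin_R[OF ml_lin(2)[OF Nil]]
      by (simp_all add: contract_def contract_t_def lin_intros)
    then show ?case by (simp add: lin2_add lin2_tau lin2_eval_shift_param)
  next
    case (Cons X Xs)
    then show ?case
      by (simp add: lin2_add lin2_tau multilinear_contract ml_contract_t)
  qed
  show "lin2 (\<lambda>y. E f (Xs @ (x, y) # Ys) z)" using assms
  proof (induction Xs arbitrary: f)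
    case Nil
    have "lin (\<lambda>y. contract (R x, R y) f Zs w)" "lin (\<lambda>y. ctr_t (x, y) f Zs w)" for Zs w
      using ml_lin(3)[OF Nil] lin_R[OF ml_lin(3)[OF Nil]]
      by (simp_all add: contract_def contract_t_def lin_intros)
    then show ?case by (simp add: lin2_add lin2_tau lin2_eval_shift_param)
  next
    case (Cons X Xs)
    then show ?case
      by (simp add: lin2_add lin2_tau multilinear_contract ml_contract_t)
  qed
qed

lemma ml_rb_delta:
  assumes "ml f" shows "ml (rb_delta f)"
  unfolding multilinear_def rb_delta_def[abs_def] using lin2_eval_shift[OF assms] lin_eval_RV by blast

lemma alternating_contract_t:
  assumes "alternating f" shows "alternating (ctr_t X f)"
proof -
  have "f (W # Ys @ (x, x) # Ws) z = 0" "f (W # Ys @ [(x, z)]) z = 0" "f (W # Ys @ [(z, x)]) z = 0" for W Ws Ys x z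
    using alternating_simps(4-6)[OF assms, of "W # Ys"] by simp_all
  then show ?thesis
    by (simp add: alternating_def contract_t_def)
qed

text \<open>
  An argument repeated in \<open>f\<close> becomes \<open>(R + t)x\<close> twice, so already the values in \<open>V[t]\<close> vanish. In
  coordinates, \<open>Rx\<close> and \<open>x\<close> meet in both orders, whence the appeal to skew-symmetry.
\<close>

lemma alternating_rb_delta:
  assumes "alternating f" "ml f" shows "alternating (rb_delta f)"
proof -
  have 1: "E f (Xs @ (x, x) # Ys) z = 0" if "alternating f" "ml f" for f Xs x Ys z
    using that
  proof (induction Xs arbitrary: f)
    case Nil
    have "contract (R x, R x) f = (\<lambda>Ws w. 0)" "ctr_t (x, x) f = (\<lambda>Ws w. 0)"
      using alternating_skew(1)[OF Nil, of "R x" x]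
      by (simp_all add: contract_def contract_t_def alternating_simps[OF Nil(1)] fun_eq_iff)
    then show ?case by (simp add: eval_shift_zero tau_0)
  next
    case (Cons X Xs)
    then show ?case
      by (simp add: multilinear_contract ml_contract_t alternating_contract alternating_contract_t tau_0)
  qed
  have 2: "E f (Xs @ [(x, z)]) z = 0" if "alternating f" "ml f" for f Xs x z
    using that
  proof (induction Xs arbitrary: f)
    case Nil
    then show ?case
      using alternating_skew(2)[OF Nil, of _ "R z" z]
      by (simp add: contract_def contract_t_def t_mult_def prod_eq_iff alternating_simps[OF Nil(1)]
          V.scale_right_distrib)
  next
    case (Cons X Xs)
    then show ?case
      by (simp add: multilinear_contract ml_contract_t alternating_contract alternating_contract_t tau_0)
  qed
  have 3: "E f (Xs @ [(z, x)]) z = 0" if "alternating f" "ml f" for f Xs x z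
    using that
  proof (induction Xs arbitrary: f)
    case Nil
    then show ?case
      using alternating_skew(3)[OF Nil, of "R z" _ z]
      by (simp add: contract_def contract_t_def t_mult_def prod_eq_iff alternating_simps[OF Nil(1)]
          V.scale_right_distrib)
  next
    case (Cons X Xs)
    then show ?case
      by (simp add: multilinear_contract ml_contract_t alternating_contract alternating_contract_t tau_0)
  qed
  have "eval_RV 0 = 0" using eval_RV_add[of 0 0] by simp
  then show ?thesis
    using assms by (simp add: alternating_def[of "rb_delta f"] rb_delta_def 1 2 3)
qed

section \<open>The coefficient of \<open>t\<close> as a sum over positions\<close>

text \<open>
  Expanding an \<open>m\<close>-fold product of summands \<open>R + t\<close>, the set \<open>T\<close> of positions of \<open>R\<close> contributes
  \<open>t\<^bsup>m - |T|\<^esup> = \<lambda>\<^bsup>m - 1 - |T|\<^esup>t\<close>, except that the full set contributes to the constant term only. Leaving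
  it out also keeps the truncated exponent meaningful.
\<close>

definition proper_sum :: "nat \<Rightarrow> (nat set \<Rightarrow> 'v) \<Rightarrow> 'v" where
  "proper_sum m h = (\<Sum>T \<in> Pow {..<m} - {{..<m}}. scaleV (lam ^ (m - 1 - card T)) (h T))"

lemma proper_sum_0: "proper_sum 0 h = 0"
  by (simp add: proper_sum_def)

text \<open>
  Multiply out the factor at position 0. The last summand is the product of its \<open>t\<close> with the constant
  term of the other factors; the other choices of \<open>t\<close> produce \<open>t\<^sup>2\<close> and hence a factor \<open>\<lambda>\<close>.
\<close>

lemma proper_sum_Suc:
  "proper_sum (Suc m) h =
     proper_sum m (\<lambda>T. scaleV lam (h (Suc ` T)) + h (insert 0 (Suc ` T))) + h (Suc ` {..<m})"
proof -
  let ?P = "Pow {..<m} - {{..<m}}"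
  let ?A = "image Suc ` ?P" and ?B = "(\<lambda>T. insert 0 (Suc ` T)) ` ?P"
  let ?w = "\<lambda>T. scaleV (lam ^ (m - card T)) (h T)"
  have inj: "inj_on (image Suc) X" "inj_on (\<lambda>T. insert 0 (Suc ` T)) X" for X :: "nat set set"
  proof -
    show "inj_on (image Suc) X" by (simp add: inj_on_def inj_image_eq_iff)
    have "insert 0 (Suc ` S) = insert 0 (Suc ` T) \<Longrightarrow> S = T" for S T
      by (metis insert_ident inj_Suc inj_image_eq_iff imageE nat.distinct(1))
    then show "inj_on (\<lambda>T. insert 0 (Suc ` T)) X" by (rule inj_onI)
  qed
  have e: "Pow {..<m} = insert {..<m} ?P" by auto
  have "g ` Pow {..<m} = insert (g {..<m}) (g ` ?P)" for g :: "nat set \<Rightarrow> nat set"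
    by (subst e) (simp only: image_insert)
  moreover have "Pow {..<Suc m} = image Suc ` Pow {..<m} \<union> (\<lambda>T. insert 0 (Suc ` T)) ` Pow {..<m}"
    unfolding lessThan_Suc_eq_insert_0 Pow_insert image_Pow_surj[OF refl, symmetric] image_image ..
  ultimately have "Pow {..<Suc m} = insert (Suc ` {..<m}) (insert {..<Suc m} (?A \<union> ?B))"
    by (simp add: lessThan_Suc_eq_insert_0 insert_commute)
  moreover have ne: "{..<Suc m} \<notin> insert (Suc ` {..<m}) (?A \<union> ?B)"
  proof -
    have "{..<Suc m} \<noteq> Suc ` T" for T by (metis imageE lessThan_iff zero_less_Suc nat.distinct(1))
    moreover have "{..<Suc m} \<notin> ?B"
      using inj(2)[of UNIV] unfolding lessThan_Suc_eq_insert_0 by (auto dest: injD)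
    ultimately show ?thesis by blast
  qed
  ultimately have *: "Pow {..<Suc m} - {{..<Suc m}} = insert (Suc ` {..<m}) (?A \<union> ?B)"
    by (simp only: insert_commute[of "Suc ` {..<m}"] Diff_insert_absorb[OF ne])
  have d: "?A \<inter> ?B = {}" "Suc ` {..<m} \<notin> ?A \<union> ?B"
  proof -
    have 0: "0 \<notin> U" if "U \<in> ?A" for U using that by auto
    have 1: "0 \<in> U" if "U \<in> ?B" for U using that by auto
    show "?A \<inter> ?B = {}" using 0 1 by blast
    have "Suc ` {..<m} \<notin> ?A" by (simp add: image_iff inj_image_eq_iff)
    moreover have "0 \<notin> Suc ` {..<m}" by simp
    ultimately show "Suc ` {..<m} \<notin> ?A \<union> ?B" using 1 by blast
  qed
  have fin: "finite ?A" "finite ?B" by simp_all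
  have c: "card (Suc ` T) = card T" "card (insert 0 (Suc ` T)) = Suc (card T)" "card T < m" if "T \<in> ?P" for T
  proof -
    have "T \<subset> {..<m}" using that by auto
    then show "card T < m" using psubset_card_mono[of "{..<m}" T] by simp
    have "finite T" using \<open>T \<subset> {..<m}\<close> finite_subset by blast
    then show "card (Suc ` T) = card T" "card (insert 0 (Suc ` T)) = Suc (card T)"
      by (simp_all add: card_image card_insert_if image_iff)
  qed
  have "sum ?w ?A = (\<Sum>T\<in>?P. scaleV (lam ^ (m - 1 - card T)) (scaleV lam (h (Suc ` T))))"
    unfolding sum.reindex[OF inj(1)] o_def
  proof (rule sum.cong[OF refl])
    fix T assume T: "T \<in> ?P"
    have "m - card T = Suc (m - 1 - card T)" using c(3)[OF T] by simp
    then show "scaleV (lam ^ (m - card (Suc ` T))) (h (Suc ` T)) = scaleV (lam ^ (m - 1 - card T)) (scaleV lam (h (Suc ` T)))"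
      using c(1)[OF T] by (simp add: mult.commute)
  qed
  moreover have "sum ?w ?B = (\<Sum>T\<in>?P. scaleV (lam ^ (m - 1 - card T)) (h (insert 0 (Suc ` T))))"
    unfolding sum.reindex[OF inj(2)] o_def by (rule sum.cong[OF refl]) (simp add: c(2))
  moreover have "proper_sum (Suc m) h = ?w (Suc ` {..<m}) + (sum ?w ?A + sum ?w ?B)"
    unfolding proper_sum_def * using sum.insert[OF _ d(2), of ?w] sum.union_disjoint[OF fin d(1), of ?w] fin by simp
  moreover have "card (Suc ` {..<m}) = m" by (simp add: card_image)
  ultimately show ?thesis
    by (simp add: proper_sum_def sum.distrib V.scale_right_distrib add.commute)
qed

lemma proper_sum_add: "proper_sum m (\<lambda>T. h T + g T) = proper_sum m h + proper_sum m g"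
  by (simp add: proper_sum_def V.scale_right_distrib sum.distrib)

lemma proper_sum_scale: "proper_sum m (\<lambda>T. scaleV c (h T)) = scaleV c (proper_sum m h)"
  by (simp add: proper_sum_def V.scale_sum_right mult.commute)

lemma apply_at_Cons:
  "apply_at R U f ((x, y) # Xs) z =
     apply_at R {j. Suc (Suc j) \<in> U} (contract (if 0 \<in> U then R x else x, if Suc 0 \<in> U then R y else y) f) Xs z"
proof -
  have "[0..<length ((x, y) # Xs)] = 0 # map Suc [0..<length Xs]"
    by (simp add: upt_conv_Cons map_Suc_upt del: upt_Suc)
  then show ?thesis
    by (simp add: apply_at_def contract_def Let_def comp_def del: upt_Suc)
qed

lemma apply_at_contract_t:
  "apply_at R T (ctr_t (x, y) f) Xs z = apply_at R T (contract (R x, y) f) Xs z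
     + apply_at R T (contract (x, R y) f) Xs z + scaleV lam (apply_at R T (contract (x, y) f) Xs z)"
  by (simp add: apply_at_def ctr_t_expand Let_def)

lemma apply_at_full: "apply_at R {..<2 * length Xs + 1} f Xs z = f (map RR Xs) (R z)"
proof -
  have "map (\<lambda>i. (R (fst (Xs ! i)), R (snd (Xs ! i)))) [0..<length Xs] = map RR Xs"
    by (rule nth_equalityI) (simp_all add: map_prod_def split_beta)
  moreover have "map (\<lambda>i. (if 2 * i \<in> {..<2 * length Xs + 1} then R (fst (Xs ! i)) else fst (Xs ! i),
      if 2 * i + 1 \<in> {..<2 * length Xs + 1} then R (snd (Xs ! i)) else snd (Xs ! i))) [0..<length Xs]
     = map (\<lambda>i. (R (fst (Xs ! i)), R (snd (Xs ! i)))) [0..<length Xs]"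
    by (rule map_cong[OF refl]) auto
  ultimately show ?thesis unfolding apply_at_def Let_def by simp
qed

lemma fst_eval_shift: "fst (E f Xs z) = f (map RR Xs) (R z)"
  by (induction Xs arbitrary: f) (simp_all add: t_mult_def contract_def)

text \<open>
  A pair of arguments occupies two flat positions, so each step of the list recursion multiplies out two
  factors; a set of positions of the longer list is a set of positions of the tail, shifted by two,
  together with a choice among the positions 0 and 1.
\<close>

lemma snd_eval_shift: "snd (E f Xs z) = proper_sum (2 * length Xs + 1) (\<lambda>T. apply_at R T f Xs z)"
proof (induction Xs arbitrary: f)
  case Nil
  show ?case by (simp add: proper_sum_Suc proper_sum_0 apply_at_def)
next
  case (Cons X Xs)
  obtain x y where X: "X = (x, y)" by force
  let ?m = "2 * length Xs + 1"
  have m: "2 * length (X # Xs) + 1 = Suc (Suc ?m)" by simp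
  have "{j. Suc (Suc j) \<in> Suc ` Suc ` T} = T" for T by auto
  moreover have "{j. Suc (Suc j) \<in> insert 0 (Suc ` Suc ` T)} = T" for T by auto
  moreover have "{j. Suc (Suc j) \<in> insert (Suc 0) (Suc ` Suc ` T)} = T" for T by auto
  moreover have "{j. Suc (Suc j) \<in> insert 0 (insert (Suc 0) (Suc ` Suc ` T))} = T" for T by auto
  ultimately have a:
    "apply_at R (Suc ` Suc ` T) f (X # Xs) z = apply_at R T (contract (x, y) f) Xs z"
    "apply_at R (insert 0 (Suc ` Suc ` T)) f (X # Xs) z = apply_at R T (contract (R x, y) f) Xs z"
    "apply_at R (insert (Suc 0) (Suc ` Suc ` T)) f (X # Xs) z = apply_at R T (contract (x, R y) f) Xs z"
    "apply_at R (insert 0 (insert (Suc 0) (Suc ` Suc ` T))) f (X # Xs) z = apply_at R T (contract (R x, R y) f) Xs z" for T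
    unfolding X apply_at_Cons by (simp_all add: image_iff)
  have full: "Suc ` {..<Suc ?m} = insert (Suc 0) (Suc ` Suc ` {..<?m})"
    by (simp add: lessThan_Suc_eq_insert_0)
  have "proper_sum (2 * length (X # Xs) + 1) (\<lambda>T. apply_at R T f (X # Xs) z)
      = proper_sum ?m (\<lambda>T. apply_at R T (contract (R x, R y) f) Xs z)
        + (apply_at R {..<?m} (ctr_t X f) Xs z + scaleV lam (proper_sum ?m (\<lambda>T. apply_at R T (ctr_t X f) Xs z)))"
    unfolding m proper_sum_Suc full image_insert a
    by (simp only: a X apply_at_contract_t proper_sum_add proper_sum_scale V.scale_right_distrib add_ac)
  then show ?case
    by (simp only: eval_shift.simps snd_add t_mult_def snd_conv Cons.IH fst_eval_shift apply_at_full X map_prod_simp)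
qed

text \<open>
  In \<open>\<delta>\<close> the positions are sorted by the number \<open>k \<le> 2n\<close> of applications of \<open>R\<close>, which leaves out
  exactly the full set of \<open>2n + 1\<close> positions.
\<close>

lemma sum_partial_R:
  assumes "length Xs = n"
  shows "(\<Sum>k\<le>2 * n. scaleV (lam ^ (2 * n - k)) (partial_R R n k f Xs z)) = snd (E f Xs z)"
proof -
  let ?P = "Pow {..<2 * n + 1} - {{..<2 * n + 1}}"
  have c: "card T \<le> 2 * n" if "T \<in> ?P" for T
  proof -
    have "T \<subset> {..<2 * n + 1}" using that by auto
    then show ?thesis using psubset_card_mono[of "{..<2 * n + 1}" T] by simp
  qed
  have "(\<Sum>k\<le>2 * n. scaleV (lam ^ (2 * n - k)) (partial_R R n k f Xs z))
      = (\<Sum>k\<le>2 * n. \<Sum>T | T \<in> ?P \<and> card T = k. scaleV (lam ^ (2 * n - card T)) (apply_at R T f Xs z))"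
  proof (rule sum.cong[OF refl])
    fix k assume "k \<in> {..2 * n}"
    then have "{T. T \<subseteq> {..<2 * n + 1} \<and> card T = k} = {T. T \<in> ?P \<and> card T = k}" by auto
    then show "scaleV (lam ^ (2 * n - k)) (partial_R R n k f Xs z) = 
       (\<Sum>T | T \<in> ?P \<and> card T = k. scaleV (lam ^ (2 * n - card T)) (apply_at R T f Xs z))"
      by (simp add: partial_R_def V.scale_sum_right)
  qed
  also have "\<dots> = (\<Sum>T\<in>?P. scaleV (lam ^ (2 * n - card T)) (apply_at R T f Xs z))"
    by (rule sum.group) (use c in auto)
  finally show ?thesis by (simp add: snd_eval_shift proper_sum_def assms)
qed

lemma delta_eq: "delta scaleV lam R RV n f Xs z = (if length Xs = n then rb_delta f Xs z else 0)"
  by (simp add: delta_def sum_partial_R rb_delta_def eval_RV_def fst_eval_shift)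

end

section \<open>The explicit coboundary and the cochain spaces\<close>

lemma omit_0: "omit 0 (X # Xs) = Xs"
  and omit_Suc: "omit (Suc i) (X # Xs) = X # omit i Xs"
  by (simp_all add: omit_def)

context three_lie_representation
begin

lemma LD_explicit:
  "LD X f Ys z = rho (fst X) (snd X) (f Ys z) - f Ys (br (fst X) (snd X) z)
     - (\<Sum>k<length Ys. f (Ys[k := (br (fst X) (snd X) (fst (Ys ! k)), snd (Ys ! k))]) z
                       + f (Ys[k := (fst (Ys ! k), br (fst X) (snd X) (snd (Ys ! k)))]) z)"
proof (induction Ys arbitrary: f)
  case (Cons Y Ys)
  show ?case
    by (simp add: Cons.IH contract_def sum.lessThan_Suc_shift algebra_simps del: sum.lessThan_Suc)
qed simp

text \<open>
  The summands of \<open>\<partial>f(X, Z\<^sub>1, \<dots>)\<close> in which \<open>X\<close> acts form \<open>L\<^sub>Xf\<close>. In all others \<open>X\<close> stays the first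
  argument of \<open>f\<close>; they form \<open>\<partial>(\<iota>\<^sub>Xf)\<close> with all signs reversed, because the indices shift by one.
\<close>

lemma coboundary_eq_CB:
  assumes "length Xs = p" "1 \<le> p"
  shows "coboundary br scaleV rho p f Xs z = CB f Xs z"
  using assms
proof (induction Xs arbitrary: f p rule: induct_list012)
  case (2 X)
  then have "p = Suc 0" by simp
  then show ?case
    by (simp add: coboundary_def omit_def V.scale_minus_left)
next
  case (3 X Y Ys)
  let ?Zs = "Y # Ys"
  define Zs where "Zs = ?Zs"
  define q where "q = length Zs"
  have p: "p = Suc q" and q: "q > 0" using 3 by (auto simp: q_def Zs_def)
  have IH: "coboundary br scaleV rho q (contract X f) Zs z = CB (contract X f) Zs z"
    unfolding Zs_def q_def by (rule 3(2)) auto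
  have ne: "Zs \<noteq> []" by (simp add: Zs_def)
  have last: "(X # Zs) ! q = Zs ! (q - 1)" "butlast (X # Zs) = X # butlast Zs"
    using q by (auto simp: q_def nth_Cons')
  have "coboundary br scaleV rho (Suc q) f (X # Zs) z
      = LD X f Zs z - coboundary br scaleV rho q (contract X f) Zs z"
    unfolding coboundary_def LD_explicit
    by (simp add: q_def[symmetric] ne last sum.lessThan_Suc_shift omit_0 omit_Suc contract_def Let_def
        sum.distrib sum_negf V.scale_minus_left V.scale_right_distrib sum_subtractf algebra_simps del: sum.lessThan_Suc)
  then show ?case unfolding p IH unfolding Zs_def by simp
qed simp

text \<open>
  On lists of the wrong length all conditions hold trivially, as the function vanishes there.
\<close>

lemma cochains_iff:
  "f \<in> cochains scaleA scaleV p \<longleftrightarrow>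
     1 \<le> p \<and> (\<forall>Xs z. length Xs \<noteq> p - 1 \<longrightarrow> f Xs z = 0) \<and> ml f \<and> alternating f"
proof (intro iffI conjI)
  assume f: "f \<in> cochains scaleA scaleV p"
  then show p: "1 \<le> p" and supp: "\<forall>Xs z. length Xs \<noteq> p - 1 \<longrightarrow> f Xs z = 0"
    unfolding cochains_def by blast+
  have z: "lin (f Xs)" if "length Xs = p - 1" for Xs
    using f that unfolding cochains_def by blast
  have i: "lin (\<lambda>t. f (Xs[i := (t, snd (Xs ! i))]) z)" "lin (\<lambda>t. f (Xs[i := (fst (Xs ! i), t)]) z)"
    "fst (Xs ! i) = snd (Xs ! i) \<Longrightarrow> f Xs z = 0" if "length Xs = p - 1" "i < p - 1" for Xs i z
    using f that unfolding cochains_def by blast+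
  have l: "f Xs z = 0" if "length Xs = p - 1" "2 \<le> p" "fst (last Xs) = z \<or> snd (last Xs) = z" for Xs z
    using f that unfolding cochains_def by blast
  have l0: "lin (\<lambda>t. 0)" by (rule lin_intros)
  show "ml f" unfolding multilinear_def
  proof (intro conjI allI)
    show "lin (f Xs)" for Xs
      by (cases "length Xs = p - 1") (use z supp l0 in \<open>auto cong: if_cong simp: lin_iff\<close>)
    fix Xs Ys :: "('a \<times> 'a) list" and y z
    show "lin (\<lambda>x. f (Xs @ (x, y) # Ys) z)"
    proof (cases "length (Xs @ (y, y) # Ys) = p - 1")
      case True
      then show ?thesis using i(1)[OF True, of "length Xs" z] by simp
    qed (use supp l0 in simp)
    show "lin (\<lambda>x. f (Xs @ (y, x) # Ys) z)"
    proof (cases "length (Xs @ (y, y) # Ys) = p - 1")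
      case True
      then show ?thesis using i(2)[OF True, of "length Xs" z] by simp
    qed (use supp l0 in simp)
  qed
  show "alternating f" unfolding alternating_def
  proof (intro conjI allI)
    fix Xs Ys :: "('a \<times> 'a) list" and x y z
    show "f (Xs @ (x, x) # Ys) z = 0"
    proof (cases "length (Xs @ (x, x) # Ys) = p - 1")
      case True
      then show ?thesis using i(3)[OF True, of "length Xs" z] by simp
    qed (use supp in simp)
    show "f (Xs @ [(x, z)]) z = 0"
    proof (cases "length (Xs @ [(x, z)]) = p - 1")
      case True
      then show ?thesis using l[OF True, of z] by simp
    qed (use supp in simp)
    show "f (Xs @ [(z, y)]) z = 0"
    proof (cases "length (Xs @ [(z, y)]) = p - 1")
      case True
      then show ?thesis using l[OF True, of z] by simp
    qed (use supp in simp)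
  qed
next
  assume a: "1 \<le> p \<and> (\<forall>Xs z. length Xs \<noteq> p - 1 \<longrightarrow> f Xs z = 0) \<and> ml f \<and> alternating f"
  then have ml: "ml f" and alt: "alternating f" by auto
  have i: "lin (\<lambda>t. f (Xs[i := (t, snd (Xs ! i))]) z)" "lin (\<lambda>t. f (Xs[i := (fst (Xs ! i), t)]) z)"
    "fst (Xs ! i) = snd (Xs ! i) \<Longrightarrow> f Xs z = 0" if i: "i < length Xs" for Xs i z
  proof -
    show "lin (\<lambda>t. f (Xs[i := (t, snd (Xs ! i))]) z)" "lin (\<lambda>t. f (Xs[i := (fst (Xs ! i), t)]) z)"
      using ml_lin(4,5)[OF ml] by (simp_all add: upd_conv_take_nth_drop[OF i])
    assume e: "fst (Xs ! i) = snd (Xs ! i)"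
    have "Xs ! i = (fst (Xs ! i), fst (Xs ! i))"
      by (simp add: prod_eq_iff e)
    then have "Xs = take i Xs @ (fst (Xs ! i), fst (Xs ! i)) # drop (Suc i) Xs"
      using id_take_nth_drop[OF i] by simp
    then show "f Xs z = 0" using alternating_simps(4)[OF alt] by metis
  qed
  have l: "f Xs z = 0" if "Xs \<noteq> []" "fst (last Xs) = z \<or> snd (last Xs) = z" for Xs z
  proof -
    have "Xs = butlast Xs @ [(fst (last Xs), snd (last Xs))]" using that(1) by simp
    then show ?thesis using that(2) alternating_simps(5,6)[OF alt] by metis
  qed
  have ne: "Xs \<noteq> []" if "length Xs = p - 1" "2 \<le> p" for Xs :: "('a \<times> 'a) list" using that by auto
  show "f \<in> cochains scaleA scaleV p"
    unfolding cochains_def using a i l ne ml_lin(1)[OF ml] by auto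
qed

lemma coboundary_cochain:
  assumes "f \<in> cochains scaleA scaleV p"
  shows "coboundary br scaleV rho p f = CB f" "CB f \<in> cochains scaleA scaleV (p + 1)"
proof -
  have f: "1 \<le> p" "\<And>Xs z. length Xs \<noteq> p - 1 \<Longrightarrow> f Xs z = 0" "ml f" "alternating f"
    using assms by (auto simp: cochains_iff)
  have supp: "CB f Xs z = 0" if "length Xs \<noteq> p" for Xs z
  proof -
    have "CB f Xs z = CB (\<lambda>Ws w. 0) Xs z"
      by (rule cartan_coboundary_cong) (use f that in auto)
    then show ?thesis by (simp add: CB_zero)
  qed
  show "coboundary br scaleV rho p f = CB f"
  proof (intro ext)
    fix Xs z show "coboundary br scaleV rho p f Xs z = CB f Xs z"
      using coboundary_eq_CB[OF _ f(1)] supp by (cases "length Xs = p") (simp_all add: coboundary_def)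
  qed
  show "CB f \<in> cochains scaleA scaleV (p + 1)"
    using supp ml_CB alternating_CB f by (simp add: cochains_iff)
qed

lemma cochains_add_scale:
  assumes "f \<in> cochains scaleA scaleV p" "g \<in> cochains scaleA scaleV p"
  shows "(\<lambda>Xs z. f Xs z + scaleV c (g Xs z)) \<in> cochains scaleA scaleV p"
  using assms unfolding cochains_iff multilinear_def alternating_def
  by (auto intro!: lin_intros)

lemma cochains_zero: "1 \<le> p \<Longrightarrow> (\<lambda>Xs z. 0) \<in> cochains scaleA scaleV p"
  by (simp add: cochains_iff multilinear_def alternating_def lin_intros)

end

section \<open>The Rota-Baxter complex\<close>

context rota_baxter_representation
begin

lemma rb_delta_cochain:
  assumes "f \<in> cochains scaleA scaleV (n + 1)"
  shows "delta scaleV lam R RV n f = rb_delta f" "rb_delta f \<in> cochains scaleA scaleV (n + 1)"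
proof -
  have f: "\<And>Xs z. length Xs \<noteq> n \<Longrightarrow> f Xs z = 0" "ml f" "alternating f"
    using assms by (auto simp: cochains_iff)
  have supp: "rb_delta f Xs z = 0" if "length Xs \<noteq> n" for Xs z
  proof -
    have "E f Xs z = E (\<lambda>Ws w. 0) Xs z"
      by (rule eval_shift_cong) (use f that in auto)
    then show ?thesis using RV_add[of 0 0] by (simp add: eval_shift_zero rb_delta_def eval_RV_def)
  qed
  show "delta scaleV lam R RV n f = rb_delta f"
    by (intro ext) (simp add: delta_eq supp)
  show "rb_delta f \<in> cochains scaleA scaleV (n + 1)"
    using supp ml_rb_delta alternating_rb_delta f by (simp add: cochains_iff)
qed

abbreviation CBR where "CBR \<equiv> cartan_coboundary brR rhoR"
abbreviation dRB where "dRB \<equiv> RB_coboundary scaleA br lam R scaleV rho RV"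
abbreviation CRB where "CRB \<equiv> RB_cochains scaleA scaleV"

text \<open>
  In degree 1 the missing second component is the zero function, whose coboundary is zero, so one formula
  covers all degrees.
\<close>

lemma RB_coboundary_eq:
  assumes n: "1 \<le> n" and c: "(f, g) \<in> CRB n"
  shows "dRB n (f, g) = (CB f, \<lambda>Xs z. CBR g Xs z + scaleV ((-1) ^ n) (rb_delta f Xs z))" (is "_ = (_, ?h)")
    and "dRB n (f, g) \<in> CRB (n + 1)"
proof -
  interpret AR: three_lie_representation scaleA brR scaleV rhoR
    by (rule three_lie_representation_RB)
  have f: "f \<in> cochains scaleA scaleV n" using c by (simp add: RB_cochains_def)
  have g: "(\<lambda>Xs z. if n = 1 then 0 else coboundary brR scaleV rhoR (n - 1) g Xs z) = CBR g \<and>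
      CBR g \<in> cochains scaleA scaleV n"
  proof (cases "n = 1")
    case True
    then have "g = (\<lambda>_ _. 0)" using c by (simp add: RB_cochains_def)
    moreover have "CBR (\<lambda>_ _. 0) = (\<lambda>_ _. 0)" by (intro ext) (rule AR.CB_zero)
    ultimately have "CBR g = (\<lambda>_ _. 0)" by simp
    then show ?thesis using True cochains_zero by simp
  next
    case False
    then have "g \<in> cochains scaleA scaleV (n - 1)" using c by (simp add: RB_cochains_def)
    from AR.coboundary_cochain[OF this] show ?thesis using False n by simp
  qed
  have D: "delta scaleV lam R RV (n - 1) f = rb_delta f" "rb_delta f \<in> cochains scaleA scaleV n"
    using rb_delta_cochain[of f "n - 1"] f n by simp_all
  show eq: "dRB n (f, g) = (CB f, ?h)"
    unfolding RB_coboundary_def prod.case coboundary_cochain(1)[OF f] D(1)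
      fun_cong[OF fun_cong[OF conjunct1[OF g]]] ..
  have "?h \<in> cochains scaleA scaleV n"
    using cochains_add_scale[OF conjunct2[OF g] D(2)] .
  then show "dRB n (f, g) \<in> CRB (n + 1)"
    unfolding eq using coboundary_cochain(2)[OF f] n by (simp add: RB_cochains_def)
qed

theorem RB_coboundary_squared:
  assumes n: "1 \<le> n" and c: "(f, g) \<in> CRB n"
  shows "dRB (n + 1) (dRB n (f, g)) = (\<lambda>_ _. 0, \<lambda>_ _. 0)"
proof -
  interpret AR: three_lie_representation scaleA brR scaleV rhoR
    by (rule three_lie_representation_RB)
  let ?h = "\<lambda>Xs z. CBR g Xs z + scaleV ((-1) ^ n) (rb_delta f Xs z)"
  have f: "ml f" using c by (simp add: RB_cochains_def cochains_iff)
  have g: "ml g"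
    using c cochains_zero[of 1] by (auto simp: RB_cochains_def cochains_iff split: if_splits)
  have in2: "(CB f, ?h) \<in> CRB (n + 1)"
    using RB_coboundary_eq[OF n c] by simp
  have "CBR ?h Xs z = scaleV ((-1) ^ n) (rb_delta (CB f) Xs z)" for Xs z
  proof -
    have "CBR ?h Xs z = CBR (CBR g) Xs z + CBR (\<lambda>Ws w. scaleV ((-1) ^ n) (rb_delta f Ws w)) Xs z"
      by (rule AR.CB_add)
    also have "CBR (CBR g) Xs z = 0" by (rule AR.CB_squared[OF g])
    also have "CBR (\<lambda>Ws w. scaleV ((-1) ^ n) (rb_delta f Ws w)) Xs z = scaleV ((-1) ^ n) (CBR (rb_delta f) Xs z)"
      by (rule cartan_coboundary_intertwine) (simp_all add: V.scale_right_distrib AR.rho_scale)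
    finally show ?thesis by (simp add: cartan_coboundary_rb_delta[OF f])
  qed
  then show ?thesis
    unfolding RB_coboundary_eq(1)[OF n c] RB_coboundary_eq(1)[OF _ in2, OF le_add2]
    by (simp add: CB_squared[OF f] V.scale_minus_left fun_eq_iff)
qed
end

theorem theorem3p3:
  fixes scaleA :: "'k::field \<Rightarrow> 'a::ab_group_add \<Rightarrow> 'a"
    and br :: "'a \<Rightarrow> 'a \<Rightarrow> 'a \<Rightarrow> 'a"
    and lam :: 'k
    and R :: "'a \<Rightarrow> 'a"
    and scaleV :: "'k \<Rightarrow> 'v::ab_group_add \<Rightarrow> 'v"
    and rho :: "'a \<Rightarrow> 'a \<Rightarrow> 'v \<Rightarrow> 'v"
    and RV :: "'v \<Rightarrow> 'v"
    and n :: nat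
  assumes "rota_baxter_three_lie_algebra scaleA br lam R"
    and "rota_baxter_representation scaleA br lam R scaleV rho RV"
    and "1 \<le> n"
  shows "\<forall>c \<in> RB_cochains scaleA scaleV n.
           RB_coboundary scaleA br lam R scaleV rho RV n c \<in> RB_cochains scaleA scaleV (n + 1) \<and>
           RB_coboundary scaleA br lam R scaleV rho RV (n + 1)
             (RB_coboundary scaleA br lam R scaleV rho RV n c) = (\<lambda>_ _. 0, \<lambda>_ _. 0)"
proof -
  interpret rota_baxter_representation scaleA br lam R scaleV rho RV by fact
  show ?thesis
    using RB_coboundary_eq(2)[OF assms(3)] RB_coboundary_squared[OF assms(3)] by auto
qed

end
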